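(* Let $\Delta$ be a simplicial complex with vertex set $\{x_1,\ldots,x_n\}$, let $\Gamma=\operatorname{Ind}(\Delta)$ be its independence complex, and let $I=\mathcal{F}(\Delta)=\mathcal{N}(\Gamma)\subseteq k[x_1,\ldots,x_n]$. The following are equivalent: (a) $\Delta$ is grafted; (b) $\Gamma$ is a generalized Bier ball; (c) $I$ is (after renaming variables) the polarization of an artinian monomial ideal. Moreover, if $I$ is the polarization of a monomial ideal $J\subseteq k[u_1,\ldots,u_m]$ minimally generated by $\{u_1^{a_1},\ldots,u_m^{a_m}\}\cup A$ (with $A$ a set of further monomials), then $\Gamma$ is vertex decomposable and $\dim(\Gamma)=a_1+\cdots+a_m-m-1$. Furthermore, $\Gamma$ is a simplicial sphere if and only if $A=\emptyset$, and otherwise $\Gamma$ is a simplicial ball.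
   Context: A simplicial complex on vertex set $V$ is a family of subsets of $V$ closed under taking subsets; facets are maximal faces; $\langle F_1,\dots,F_q\rangle$ denotes the complex with facets $F_1,\dots,F_q$. A subset $W\subseteq V$ is independent in $\Delta$ if it contains no facet of $\Delta$; $\operatorname{Ind}(\Delta)$ is the complex of independent sets. The facet ideal is $\mathcal{F}(\Delta)=(\prod_{x\in F}x : F \text{ a facet of }\Delta)$ and the Stanley–Reisner ideal is $\mathcal{N}(\Gamma)=(\prod_{x\in W}x: W\notin\Gamma)$; conversely $\mathcal{N}(I)$ denotes the Stanley–Reisner complex of a square-free monomial ideal $I$. Polarization: for $m=u_1^{b_1}\cdots u_m^{b_m}$, $\mathcal{P}(m)=\prod_{i}\prod_{j=1}^{b_i} x_{i,j}$; for $J$ minimally generated by $m_1,\dots,m_q$, $\mathcal{P}(J)=(\mathcal{P}(m_1),\dots,\mathcal{P}(m_q))$ in the polynomial ring on the variables appearing. A monomial ideal in $k[u_1,\dots,u_m]$ is artinian if it contains a power of each $u_i$. A generalized Bier ball is the Stanley–Reisner complex $\mathcal{N}(\mathcal{P}(J))$ of the polarization of an artinian monomial ideal $J$. A leaf of a simplicial complex $\Delta$ is a facet $F$ such that either $F$ is the only facet, or there is another facet $G$ (a joint of $F$) with $F\cap H\subseteq G$ for every facet $H\neq F$. $\Delta$ is grafted (a grafting of $\Delta'=\langle G_1,\dots,G_s\rangle$ with simplices $F_1,\dots,F_r$) if $\Delta=\langle F_1,\dots,F_r\rangle\cup\langle G_1,\dots,G_s\rangle$ where: (1) $V(\Delta')\subseteq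 V(F_1)\cup\cdots\cup V(F_r)$; (2) $F_1,\dots,F_r$ are all the leaves of $\Delta$; (3) $\{G_1,\dots,G_s\}\cap\{F_1,\dots,F_r\}=\emptyset$; (4) $F_i\cap F_j=\emptyset$ for $i\neq j$; (5) if $G_i$ is a joint of $\Delta$, then the complex obtained from $\Delta$ by removing the facet $G_i$ is also grafted. A simplicial sphere (ball) of dimension $d$ is a complex whose geometric realization is homeomorphic to the $d$-sphere ($d$-ball). Vertex decomposable: $\Delta$ is empty or a simplex, or there is a vertex $v$ such that every facet of $\mathrm{del}_\Delta(v)$ is a facet of $\Delta$ and both $\mathrm{link}_\Delta(v)$ and $\mathrm{del}_\Delta(v)$ are vertex decomposable. *)

theory Defs
  imports
    "HOL-Analysis.Analysis"
    "HOL-Algebra.Ideal"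
    "HOL-Library.Poly_Mapping"
begin

section \<open>Simplicial complexes\<close>

definition simplicial_complex :: "'v set \<Rightarrow> 'v set set \<Rightarrow> bool" where
  "simplicial_complex V D \<longleftrightarrow> D \<subseteq> Pow V \<and> (\<forall>F\<in>D. \<forall>G. G \<subseteq> F \<longrightarrow> G \<in> D)"

definition facets :: "'v set set \<Rightarrow> 'v set set" where
  "facets D = {F \<in> D. \<forall>G\<in>D. F \<subseteq> G \<longrightarrow> G = F}"

definition antichain_sets :: "'v set set \<Rightarrow> bool" where
  "antichain_sets S \<longleftrightarrow> (\<forall>F\<in>S. \<forall>G\<in>S. F \<subseteq> G \<longrightarrow> F = G)"

text \<open>The complex \<open>\<langle>F\<^sub>1, \<dots>, F\<^sub>q\<rangle>\<close>; its facets are exactly the members of \<open>S\<close> whenever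
  \<open>S\<close> is an antichain.\<close>

definition complex_of :: "'v set set \<Rightarrow> 'v set set" where
  "complex_of S = {H. \<exists>F\<in>S. H \<subseteq> F}"

definition Ind :: "'v set \<Rightarrow> 'v set set \<Rightarrow> 'v set set" where
  "Ind V D = {W. W \<subseteq> V \<and> (\<forall>F\<in>facets D. \<not> F \<subseteq> W)}"

text \<open>For nonempty finite complexes; the complex \<open>{{}}\<close> has dimension \<open>-1\<close>.\<close>

definition dim_complex :: "'v set set \<Rightarrow> int" where
  "dim_complex D = int (Max (card ` D)) - 1"

text \<open>Vertex sets are part of the data: a point of \<open>V\<close> need not be a face.\<close>

definition complex_iso :: "'v set \<Rightarrow> 'v set set \<Rightarrow> 'w set \<Rightarrow> 'w set set \<Rightarrow> bool" where
  "complex_iso V D W E \<longleftrightarrow> (\<exists>\<sigma>. bij_betw \<sigma> V W \<and> E = image \<sigma> ` D)"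


subsection \<open>Vertex decomposability\<close>

definition link :: "'v set set \<Rightarrow> 'v \<Rightarrow> 'v set set" where
  "link D v = {F. v \<notin> F \<and> insert v F \<in> D}"

definition del :: "'v set set \<Rightarrow> 'v \<Rightarrow> 'v set set" where
  "del D v = {F \<in> D. v \<notin> F}"

inductive vertex_decomposable :: "'v set set \<Rightarrow> bool" where
  empty: "vertex_decomposable {}"
| simplex: "finite F \<Longrightarrow> vertex_decomposable (Pow F)"
| shed: "\<lbrakk>{v} \<in> D; facets (del D v) \<subseteq> facets D;
          vertex_decomposable (link D v); vertex_decomposable (del D v)\<rbrakk>
         \<Longrightarrow> vertex_decomposable D"


subsection \<open>Grafted complexes\<close>

definition joint_of :: "'v set set \<Rightarrow> 'v set \<Rightarrow> 'v set \<Rightarrow> bool" where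
  "joint_of D F G \<longleftrightarrow> F \<in> facets D \<and> G \<in> facets D \<and> G \<noteq> F \<and>
     (\<forall>H\<in>facets D. H \<noteq> F \<longrightarrow> F \<inter> H \<subseteq> G)"

definition leaf :: "'v set set \<Rightarrow> 'v set \<Rightarrow> bool" where
  "leaf D F \<longleftrightarrow> F \<in> facets D \<and> (facets D = {F} \<or> (\<exists>G. joint_of D F G))"

text \<open>\<open>Fs\<close> and \<open>Gs\<close> are the sets \<open>{F\<^sub>1, \<dots>, F\<^sub>r}\<close> and \<open>{G\<^sub>1, \<dots>, G\<^sub>s}\<close>. The recursion in the last
  condition is well founded, since the number of facets decreases.\<close>

inductive grafted :: "'v set set \<Rightarrow> bool" where
  "\<lbrakk>finite Fs; finite Gs; antichain_sets Fs; antichain_sets Gs;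
    D = complex_of Fs \<union> complex_of Gs;
    \<Union>Gs \<subseteq> \<Union>Fs;
    Fs = {F. leaf D F};
    Gs \<inter> Fs = {};
    \<forall>F\<in>Fs. \<forall>F'\<in>Fs. F \<noteq> F' \<longrightarrow> F \<inter> F' = {};
    \<forall>G\<in>Gs. (\<exists>F. leaf D F \<and> joint_of D F G) \<longrightarrow> grafted (complex_of (facets D - {G}))\<rbrakk>
   \<Longrightarrow> grafted D"


subsection \<open>Simplicial spheres and balls\<close>

text \<open>Barycentric coordinates. For the finite complexes considered here the product topology
  induces the usual topology on the geometric realization.\<close>

definition geom_realization :: "'v set set \<Rightarrow> ('v \<Rightarrow> real) topology" where
  "geom_realization D = subtopology (powertop_real UNIV)
     {\<alpha>. (\<forall>v. 0 \<le> \<alpha> v) \<and> {v. \<alpha> v \<noteq> 0} \<in> D \<and> (\<Sum>v\<in>{v. \<alpha> v \<noteq> 0}. \<alpha> v) = 1}"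

text \<open>The \<open>(-1)\<close>-sphere is the empty space, i.e. the realization of \<open>{{}}\<close>; the dimension is
  therefore an integer.\<close>

definition simplicial_sphere_of_dim :: "int \<Rightarrow> 'v set set \<Rightarrow> bool" where
  "simplicial_sphere_of_dim d D \<longleftrightarrow>
     (if d = -1 then D = {{}}
      else d \<ge> 0 \<and> geom_realization D homeomorphic_space nsphere (nat d))"

definition closed_ball_space :: "nat \<Rightarrow> (nat \<Rightarrow> real) topology" where
  "closed_ball_space d = subtopology (Euclidean_space d) {x. (\<Sum>i<d. (x i)\<^sup>2) \<le> 1}"

definition simplicial_ball_of_dim :: "nat \<Rightarrow> 'v set set \<Rightarrow> bool" where
  "simplicial_ball_of_dim d D \<longleftrightarrow> geom_realization D homeomorphic_space closed_ball_space d"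

definition simplicial_sphere :: "'v set set \<Rightarrow> bool" where
  "simplicial_sphere D \<longleftrightarrow> (\<exists>d. simplicial_sphere_of_dim d D)"

definition simplicial_ball :: "'v set set \<Rightarrow> bool" where
  "simplicial_ball D \<longleftrightarrow> (\<exists>d. simplicial_ball_of_dim d D)"


section \<open>Monomial ideals\<close>

text \<open>A monomial is given by its exponent vector, of type \<open>'x \<Rightarrow>\<^sub>0 nat\<close>; a polynomial is a
  finitely supported function from monomials to coefficients. \<open>poly_ring X\<close> is \<open>k[X]\<close>.\<close>

type_synonym ('x, 'k) mpoly = "('x \<Rightarrow>\<^sub>0 nat) \<Rightarrow>\<^sub>0 'k"

definition mons_on :: "'x set \<Rightarrow> ('x \<Rightarrow>\<^sub>0 nat) set" where
  "mons_on X = {t. Poly_Mapping.keys t \<subseteq> X}"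

definition mon :: "('x \<Rightarrow>\<^sub>0 nat) \<Rightarrow> ('x, 'k::field) mpoly" where
  "mon t = Poly_Mapping.single t 1"

definition pvar :: "'x \<Rightarrow> ('x, 'k::field) mpoly" where
  "pvar x = mon (Poly_Mapping.single x 1)"

definition poly_ring :: "'x set \<Rightarrow> ('x, 'k::field) mpoly ring" where
  "poly_ring X = \<lparr>carrier = {p. Poly_Mapping.keys p \<subseteq> mons_on X},
                  monoid.mult = (*), one = 1, ring.zero = 0, add = (+)\<rparr>"

lemma cring_poly_ring: "cring (poly_ring X :: ('x, 'k::field) mpoly ring)"
proof -
  let ?C = "{p :: ('x, 'k) mpoly. Poly_Mapping.keys p \<subseteq> mons_on X}"
  have add: "p + q \<in> ?C" if "p \<in> ?C" "q \<in> ?C" for p q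
    using that keys_add[of p q] by blast
  have mult: "p * q \<in> ?C" if "p \<in> ?C" "q \<in> ?C" for p q
  proof -
    have "a + b \<in> mons_on X" if "a \<in> mons_on X" "b \<in> mons_on X" for a b
      using that keys_add[of a b] by (auto simp: mons_on_def)
    then show ?thesis
      using that keys_mult[of p q] by blast
  qed
  have one: "1 \<in> ?C"
    by (auto simp: mons_on_def single_one[symmetric] simp del: single_one)
  show ?thesis
  proof (rule cringI)
    show "abelian_group (poly_ring X :: ('x, 'k) mpoly ring)"
    proof (rule abelian_groupI)
      fix p :: "('x, 'k) mpoly"
      assume "p \<in> carrier (poly_ring X)"
      then show "\<exists>q\<in>carrier (poly_ring X). q \<oplus>\<^bsub>poly_ring X\<^esub> p = \<zero>\<^bsub>poly_ring X\<^esub>"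
        by (intro bexI[of _ "- p"]) (auto simp: poly_ring_def)
    qed (use add in \<open>auto simp: poly_ring_def ac_simps\<close>)
    show "Group.comm_monoid (poly_ring X :: ('x, 'k) mpoly ring)"
      by (rule comm_monoidI) (use mult one in \<open>auto simp: poly_ring_def ac_simps\<close>)
  qed (auto simp: poly_ring_def algebra_simps)
qed

definition facet_ideal :: "'v set \<Rightarrow> 'v set set \<Rightarrow> ('v, 'k::field) mpoly set" where
  "facet_ideal V D = Idl\<^bsub>poly_ring V\<^esub> {\<Prod>x\<in>F. pvar x | F. F \<in> facets D}"

definition SR_ideal :: "'v set \<Rightarrow> 'v set set \<Rightarrow> ('v, 'k::field) mpoly set" where
  "SR_ideal V D = Idl\<^bsub>poly_ring V\<^esub> {\<Prod>x\<in>W. pvar x | W. W \<subseteq> V \<and> W \<notin> D}"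

definition SR_complex :: "'v set \<Rightarrow> ('v, 'k::field) mpoly set \<Rightarrow> 'v set set" where
  "SR_complex V I = {W. W \<subseteq> V \<and> (\<Prod>x\<in>W. pvar x) \<notin> I}"

definition monomial_ideal :: "'x set \<Rightarrow> ('x, 'k::field) mpoly set \<Rightarrow> bool" where
  "monomial_ideal X J \<longleftrightarrow> (\<exists>M \<subseteq> mons_on X. J = Idl\<^bsub>poly_ring X\<^esub> (mon ` M))"

definition artinian_monomial_ideal :: "'x set \<Rightarrow> ('x, 'k::field) mpoly set \<Rightarrow> bool" where
  "artinian_monomial_ideal X J \<longleftrightarrow> monomial_ideal X J \<and> (\<forall>x\<in>X. \<exists>b. pvar x ^ b \<in> J)"

definition minimally_generates ::
    "'x set \<Rightarrow> ('x \<Rightarrow>\<^sub>0 nat) set \<Rightarrow> ('x, 'k::field) mpoly set \<Rightarrow> bool" where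
  "minimally_generates X M J \<longleftrightarrow> M \<subseteq> mons_on X \<and> Idl\<^bsub>poly_ring X\<^esub> (mon ` M) = J \<and>
     (\<forall>M'. M' \<subset> M \<longrightarrow> Idl\<^bsub>poly_ring X\<^esub> (mon ` M') \<noteq> J)"

text \<open>A monomial ideal has exactly one minimal set of monomial generators.\<close>

definition min_gens :: "'x set \<Rightarrow> ('x, 'k::field) mpoly set \<Rightarrow> ('x \<Rightarrow>\<^sub>0 nat) set" where
  "min_gens X J = (THE M. minimally_generates X M J)"


subsection \<open>Polarization\<close>

text \<open>The new variable \<open>x\<^sub>i\<^sub>,\<^sub>j\<close> is the pair \<open>(i, j)\<close>, with \<open>j \<ge> 1\<close>.\<close>

definition pol_mon :: "('x \<Rightarrow>\<^sub>0 nat) \<Rightarrow> ('x \<times> nat, 'k::field) mpoly" where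
  "pol_mon t = (\<Prod>i\<in>Poly_Mapping.keys t. \<Prod>j = 1..Poly_Mapping.lookup t i. pvar (i, j))"

definition pol_vars :: "'x set \<Rightarrow> ('x, 'k::field) mpoly set \<Rightarrow> ('x \<times> nat) set" where
  "pol_vars X J = {(i, j). \<exists>t\<in>min_gens X J. 1 \<le> j \<and> j \<le> Poly_Mapping.lookup t i}"

definition polarization ::
    "'x set \<Rightarrow> ('x, 'k::field) mpoly set \<Rightarrow> ('x \<times> nat, 'k) mpoly set" where
  "polarization X J = Idl\<^bsub>poly_ring (pol_vars X J)\<^esub> (pol_mon ` min_gens X J)"

definition rename_mon :: "('x \<Rightarrow> 'y) \<Rightarrow> ('x \<Rightarrow>\<^sub>0 nat) \<Rightarrow> ('y \<Rightarrow>\<^sub>0 nat)" where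
  "rename_mon \<sigma> t =
     (\<Sum>x\<in>Poly_Mapping.keys t. Poly_Mapping.single (\<sigma> x) (Poly_Mapping.lookup t x))"

definition rename_poly :: "('x \<Rightarrow> 'y) \<Rightarrow> ('x, 'k::field) mpoly \<Rightarrow> ('y, 'k) mpoly" where
  "rename_poly \<sigma> p =
     (\<Sum>t\<in>Poly_Mapping.keys p. Poly_Mapping.single (rename_mon \<sigma> t) (Poly_Mapping.lookup p t))"

text \<open>The ideal \<open>I\<close> of \<open>k[V]\<close> is, after renaming variables, the polarization of the ideal \<open>J\<close>
  of \<open>k[X]\<close>.\<close>

definition is_polarization_of ::
    "'v set \<Rightarrow> ('v, 'k::field) mpoly set \<Rightarrow> 'x set \<Rightarrow> ('x, 'k) mpoly set \<Rightarrow> bool" where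
  "is_polarization_of V I X J \<longleftrightarrow>
     (\<exists>\<sigma>. bij_betw \<sigma> (pol_vars X J) V \<and> I = rename_poly \<sigma> ` polarization X J)"

text \<open>The variables \<open>u\<^sub>1, \<dots>, u\<^sub>m\<close> are the numbers \<open>1, \<dots>, m\<close>. Being a generalized Bier ball is
  understood up to relabelling of the vertices \<open>(i, j)\<close>. The field of coefficients does not occur
  in the types of the other arguments and is passed as a type argument.\<close>

definition generalized_Bier_ball :: "'k::field itself \<Rightarrow> 'v set \<Rightarrow> 'v set set \<Rightarrow> bool" where
  "generalized_Bier_ball K V D \<longleftrightarrow>
     (\<exists>(m::nat) (J :: (nat, 'k) mpoly set). artinian_monomial_ideal {1..m} J \<and>
        complex_iso (pol_vars {1..m} J) (SR_complex (pol_vars {1..m} J) (polarization {1..m} J)) V D)"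

end

theory Submission
  imports Defs "HOL-Homology.Homology"
begin

text \<open>Both grafted complexes and polarizations of artinian ideals amount to a facet set with disjoint
  members \<open>F\<^sub>1, \<dots>, F\<^sub>r\<close> covering all vertices, on each of which the facets leave nested traces:
  ordering every \<open>F\<^sub>i\<close> so that the traces become initial segments turns facets into polarized
  monomials. Shedding a vertex common to all nonempty traces on some \<open>F\<^sub>i\<close> yields vertex
  decomposability. For the topology no shellability argument is needed. The join of the boundaries
  of the \<open>F\<^sub>i\<close> is the boundary of a simplicial polytope, hence a sphere, and a direction that
  increases along each ordered \<open>F\<^sub>i\<close> points into the interior of the cone over \<open>\<Gamma>\<close> at every point of
  that cone. The cone over a proper \<open>\<Gamma>\<close> is therefore a region under a continuous, positively
  homogeneous graph, so \<open>\<Gamma>\<close> is homeomorphic to a hemisphere.\<close>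

section \<open>Facets and independence complexes\<close>

text \<open>The three conditions meet in the family \<open>S\<close> of facets: an antichain is
  recovered from its independence complex as the set of minimal non-faces, and from its ideal as the
  set of minimal generators. Equalities of complexes and of ideals thus become equalities of
  families, in which the field no longer occurs.

  The topological part needs one direction that enters the cone over \<open>indep V S\<close> at all
  its points simultaneously, although this cone is in general not convex. Nestedness supplies it: if
  \<open>x\<close> lies in a trace and \<open>y\<close> in the same cell outside it, every member of
  \<open>S\<close> through \<open>y\<close> also passes through \<open>x\<close>. So the number of
  members through a point drops strictly on leaving a trace. On each line in the resulting direction
  the cone is a closed ray whose end point varies continuously and positively homogeneously.
  Reflecting each line so that this end point is exchanged with the zero of one linear coordinate
  flattens the boundary. If no facet lies outside \<open>Fs\<close>, no such bound arises and the
  whole sphere remains.\<close>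

definition indep :: "'v set \<Rightarrow> 'v set set \<Rightarrow> 'v set set" where
  "indep V S = {W. W \<subseteq> V \<and> (\<forall>F\<in>S. \<not> F \<subseteq> W)}"

lemma Ind_eq_indep: "Ind V D = indep V (facets D)"
  by (simp add: Ind_def indep_def)

text \<open>Members of an antichain are the minimal subsets of \<open>V\<close> that are not
  independent, so the complex determines them. Every later comparison of complexes or ideals is
  reduced to facets in this way.\<close>

lemma indep_antichain_eqD:
  assumes "antichain_sets S" "antichain_sets T" "S \<subseteq> Pow V" "T \<subseteq> Pow V" "indep V S = indep V T"
  shows "S = T"
proof -
  have "A \<subseteq> B" if A: "antichain_sets A" "A \<subseteq> Pow V" and B: "B \<subseteq> Pow V" and eq: "indep V A = indep V B" 
    for A B :: "'a set set"
  proof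
    fix F assume F: "F \<in> A"
    then have "F \<notin> indep V B" using A eq by (auto simp: indep_def)
    then obtain G where G: "G \<in> B" "G \<subseteq> F" using F A by (auto simp: indep_def)
    then have "G \<notin> indep V A" using eq B by (auto simp: indep_def)
    then obtain F' where "F' \<in> A" "F' \<subseteq> G" using G B by (auto simp: indep_def)
    then have "F' = F" using A F G(2) by (meson antichain_sets_def order_trans)
    then show "F \<in> B" using \<open>F' \<subseteq> G\<close> G by auto
  qed
  from this[of S T] this[of T S] assms show ?thesis by auto
qed

lemma facets_subset: "facets D \<subseteq> D"
  by (auto simp: facets_def)

lemma antichain_facets: "antichain_sets (facets D)"
  by (auto simp: antichain_sets_def facets_def)

lemma antichain_subset: "antichain_sets S \<Longrightarrow> T \<subseteq> S \<Longrightarrow> antichain_sets T"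
  by (auto simp: antichain_sets_def)

lemma facets_complex_of: "antichain_sets S \<Longrightarrow> facets (complex_of S) = S"
  by (auto simp: antichain_sets_def facets_def complex_of_def) blast+

lemma face_subset_facet:
  assumes "finite D" "A \<in> D"
  obtains F where "F \<in> facets D" "A \<subseteq> F"
proof -
  obtain F where "F \<in> D" "A \<subseteq> F" "\<And>G. G \<in> D \<Longrightarrow> F \<subseteq> G \<Longrightarrow> F = G"
    using finite_has_maximal2[OF assms] by metis
  then show ?thesis by (intro that) (auto simp: facets_def)
qed

lemma complex_of_facets:
  assumes "finite D" "simplicial_complex V D"
  shows "complex_of (facets D) = D"
proof
  show "complex_of (facets D) \<subseteq> D"
    using assms(2) by (auto simp: complex_of_def simplicial_complex_def facets_def)
  show "D \<subseteq> complex_of (facets D)"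
    using face_subset_facet[OF assms(1)] by (auto simp: complex_of_def) blast
qed

section \<open>Grafted complexes\<close>

text \<open>Enumerating each \<open>F \<in> Fs\<close> so that all traces are initial segments exhibits \<open>S\<close> as a set of
  polarized monomials.\<close>

definition grafting :: "'v set set \<Rightarrow> 'v set set \<Rightarrow> bool" where
  "grafting Fs S \<longleftrightarrow> Fs \<subseteq> S \<and> \<Union>S \<subseteq> \<Union>Fs \<and>
     (\<forall>F\<in>Fs. \<forall>F'\<in>Fs. F \<noteq> F' \<longrightarrow> F \<inter> F' = {}) \<and>
     (\<forall>F\<in>Fs. \<forall>G\<in>S. \<forall>H\<in>S. G \<inter> F \<subseteq> H \<inter> F \<or> H \<inter> F \<subseteq> G \<inter> F)"

lemma graftingD:
  assumes "grafting Fs S"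
  shows "Fs \<subseteq> S" "\<Union>S \<subseteq> \<Union>Fs"
    "\<And>F F'. F \<in> Fs \<Longrightarrow> F' \<in> Fs \<Longrightarrow> F \<noteq> F' \<Longrightarrow> F \<inter> F' = {}"
    "\<And>F G H. F \<in> Fs \<Longrightarrow> G \<in> S \<Longrightarrow> H \<in> S \<Longrightarrow> G \<inter> F \<subseteq> H \<inter> F \<or> H \<inter> F \<subseteq> G \<inter> F"
  using assms by (simp_all add: grafting_def)

lemma grafting_subset:
  assumes "grafting Fs S" "Fs \<subseteq> T" "T \<subseteq> S"
  shows "grafting Fs T"
proof -
  note gr = graftingD[OF assms(1)]
  have "\<Union>T \<subseteq> \<Union>Fs" using gr(2) assms(3) by blast
  moreover have "G \<inter> F \<subseteq> H \<inter> F \<or> H \<inter> F \<subseteq> G \<inter> F" if "F \<in> Fs" "G \<in> T" "H \<in> T" for F G H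
    using gr(4)[of F G H] that assms(3) by auto
  ultimately show ?thesis
    unfolding grafting_def using gr(3) assms(2) by (intro conjI ballI impI) simp_all
qed

text \<open>A joint of \<open>F\<close> would contain the intersection of \<open>F\<close> with each
  member of \<open>Fs\<close>. These intersections cover \<open>F\<close>, so the joint would
  contain the facet \<open>F\<close> itself.\<close>

lemma not_leaf_if_covered:
  assumes "Fs \<subseteq> facets D" "F \<subseteq> \<Union>Fs" "F \<noteq> {}" "F \<notin> Fs"
  shows "\<not> leaf D F"
proof
  assume "leaf D F"
  moreover obtain F0 where "F0 \<in> Fs" using assms(2,3) by blast
  then have "F0 \<in> facets D" "F0 \<noteq> F" using assms(1,4) by auto
  then have "facets D \<noteq> {F}" by auto
  ultimately obtain G where G: "joint_of D F G" by (auto simp: leaf_def)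
  then have "F \<inter> H \<subseteq> G" if "H \<in> Fs" for H
    using that assms by (auto simp: joint_of_def)
  then have "F \<subseteq> G" using assms(2) by blast
  then show False using G by (auto simp: joint_of_def facets_def)
qed

text \<open>The traces of the other facets on a member of \<open>Fs\<close> form a finite chain, so
  a maximal trace is the largest one and its facet is a joint. All remaining facets are covered by
  \<open>Fs\<close> and cannot be leaves.\<close>

lemma grafting_leaves:
  assumes "grafting Fs (facets D)" "finite (facets D)" "{} \<notin> facets D"
  shows "{F. leaf D F} = Fs"
proof (intro equalityI subsetI)
  fix F assume "F \<in> {F. leaf D F}"
  then have F: "leaf D F" "F \<in> facets D" by (auto simp: leaf_def)
  have "F \<noteq> {}" "F \<subseteq> \<Union>Fs" using F assms(3) graftingD(2)[OF assms(1)] by auto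
  then show "F \<in> Fs" using not_leaf_if_covered graftingD(1)[OF assms(1)] F(1) by blast
next
  fix F assume F: "F \<in> Fs"
  then have FD: "F \<in> facets D" using graftingD(1)[OF assms(1)] by blast
  show "F \<in> {F. leaf D F}"
  proof (cases "facets D = {F}")
    case True
    then show ?thesis by (simp add: leaf_def)
  next
    case False
    define X where "X = (\<lambda>G. G \<inter> F) ` (facets D - {F})"
    have "finite X" "X \<noteq> {}" using assms(2) False FD by (auto simp: X_def)
    then obtain T where T: "T \<in> X" "\<And>U. U \<in> X \<Longrightarrow> T \<subseteq> U \<Longrightarrow> T = U"
      using finite_has_maximal by metis
    then obtain G where G: "G \<in> facets D" "G \<noteq> F" "T = G \<inter> F" by (auto simp: X_def)
    have "F \<inter> H \<subseteq> G" if H: "H \<in> facets D" "H \<noteq> F" for H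
    proof -
      have "G \<inter> F \<subseteq> H \<inter> F \<or> H \<inter> F \<subseteq> G \<inter> F"
        using graftingD(4)[OF assms(1) F G(1) H(1)] .
      moreover have "H \<inter> F \<in> X" using H by (auto simp: X_def)
      ultimately show ?thesis using T(2)[of "H \<inter> F"] G(3) by blast
    qed
    then have "joint_of D F G" using FD G by (auto simp: joint_of_def)
    then show ?thesis using FD by (auto simp: leaf_def)
  qed
qed

text \<open>A trace chain on a leaf \<open>F\<close> extends over a removed joint \<open>G\<close> because \<open>G\<close> contains every
  other trace on \<open>F\<close>; the covering condition forces \<open>F\<close> to remain a leaf once \<open>G\<close> is removed.\<close>

lemma grafted_imp_grafting:
  "grafted D \<Longrightarrow> finite (facets D) \<and> grafting {F. leaf D F} (facets D)"
proof (induction rule: grafted.induct)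
  case (1 Fs Gs D)
  note leaves = 1(7)
  have Fs_facets: "Fs \<subseteq> facets D" using leaves by (auto simp: leaf_def)
  have facets_sub: "facets D \<subseteq> Fs \<union> Gs"
  proof
    fix F assume F: "F \<in> facets D"
    then obtain F' where "F' \<in> Fs \<union> Gs" "F \<subseteq> F'" "F' \<in> D"
      unfolding 1(5) facets_def complex_of_def by blast
    then show "F \<in> Fs \<union> Gs" using F by (auto simp: facets_def)
  qed
  then have fin: "finite (facets D)" using 1(1,2) finite_subset by blast
  have cover: "\<Union>(facets D) \<subseteq> \<Union>Fs" using facets_sub 1(6) by blast
  have disj: "F \<inter> F' = {}" if "F \<in> Fs" "F' \<in> Fs" "F \<noteq> F'" for F F'
    using 1(9) that by blast
  have nested: "G \<inter> F \<subseteq> H \<inter> F \<or> H \<inter> F \<subseteq> G \<inter> F"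
    if F: "F \<in> Fs" and GH: "G \<in> facets D" "H \<in> facets D" for F G H
  proof (cases "facets D = {F}")
    case True
    then show ?thesis using GH by auto
  next
    case False
    have "leaf D F" using F leaves by blast
    then obtain G0 where G0: "joint_of D F G0" using False by (auto simp: leaf_def)
    \<comment> \<open>If the joint \<open>G0\<close> is in \<open>Fs\<close>, it is disjoint from
      \<open>F\<close>, and then so is every other facet. Otherwise \<open>G0\<close> is one of the
      \<open>Gs\<close> and the recursive clause applies to it.\<close>
    show ?thesis
    proof (cases "G0 \<in> Fs")
      case True
      then have "F \<inter> G0 = {}" using disj F G0 by (auto simp: joint_of_def)
      then have "F \<inter> H = {}" if "H \<in> facets D" "H \<noteq> F" for H
        using G0 that unfolding joint_of_def by blast
      then show ?thesis using GH by blast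
    next
      case G0Fs: False
      define D' where "D' = complex_of (facets D - {G0})"
      have G0D: "G0 \<in> facets D" using G0 by (simp add: joint_of_def)
      then have "G0 \<in> Gs" using facets_sub G0Fs by blast
      then have IH: "grafting {F. leaf D' F} (facets D')"
        using 1(10) G0 \<open>leaf D F\<close> unfolding D'_def by blast
      have fD': "facets D' = facets D - {G0}" unfolding D'_def
        by (intro facets_complex_of antichain_subset[OF antichain_facets]) auto
      have Fs': "Fs \<subseteq> facets D'" using fD' Fs_facets G0Fs by blast
      have leafF: "leaf D' F"
      proof (rule ccontr)
        assume nl: "\<not> leaf D' F"
        have "F \<noteq> {}"
        proof
          assume "F = {}"
          then have "G = F" if "G \<in> facets D" for G
            using that F Fs_facets by (auto simp: facets_def)
          then show False using False F Fs_facets by blast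
        qed
        \<comment> \<open>By the covering condition of the smaller complex some leaf
          \<open>F'\<close> of it passes through \<open>x\<close>. If \<open>F'\<close> were in
          \<open>Fs\<close>, disjointness would make it equal to \<open>F\<close>, which is assumed
          not to be a leaf; outside \<open>Fs\<close> it is covered by \<open>Fs\<close> and is no
          leaf either.\<close>
        then obtain x where x: "x \<in> F" by blast
        then have "x \<in> \<Union>(facets D')" using F Fs' by blast
        then obtain F' where F': "leaf D' F'" "x \<in> F'" using graftingD(2)[OF IH] by blast
        then have "F' \<in> facets D'" by (simp add: leaf_def)
        moreover have "F' \<notin> Fs" using disj[OF F, of F'] F' x nl by auto
        moreover have "F' \<subseteq> \<Union>Fs" using cover fD' calculation(1) by blast
        ultimately show False using not_leaf_if_covered[OF Fs'] F' by blast
      qed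
      have chain: "A \<inter> F \<subseteq> B \<inter> F \<or> B \<inter> F \<subseteq> A \<inter> F" 
        if "A \<in> facets D - {G0}" "B \<in> facets D - {G0}" for A B
        using graftingD(4)[OF IH, of F A B] leafF that fD' by auto
      have top: "A \<inter> F \<subseteq> G0 \<inter> F" if "A \<in> facets D" "A \<noteq> F" for A
        using G0 that unfolding joint_of_def by blast
      show ?thesis
      proof (cases "G = G0 \<or> H = G0")
        case True
        then show ?thesis using top GH by blast
      next
        case False
        then show ?thesis using chain GH by blast
      qed
    qed
  qed
  have "grafting Fs (facets D)"
    unfolding grafting_def using Fs_facets cover disj nested by (intro conjI ballI impI) simp_all
  then show ?case using fin leaves by simp
qed

text \<open>Removing any facet outside \<open>Fs\<close> keeps nestedness and covering, so the
  recursive clause is available by induction for all facets in \<open>S - Fs\<close>, in particular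
  for the joints among them.\<close>

lemma grafting_imp_grafted:
  assumes "finite S" "antichain_sets S" "{} \<notin> S" "grafting Fs S"
  shows "grafted (complex_of S)"
  using assms
proof (induction "card S" arbitrary: S rule: less_induct)
  case less
  let ?D = "complex_of S"
  have facets: "facets ?D = S" by (rule facets_complex_of[OF less.prems(2)])
  have FsS: "Fs \<subseteq> S" using graftingD(1)[OF less.prems(4)] .
  have D: "?D = complex_of Fs \<union> complex_of (S - Fs)" using FsS by (auto simp: complex_of_def)
  have lv: "Fs = {F. leaf ?D F}"
    using grafting_leaves[of Fs ?D] less.prems facets by simp
  have rec: "grafted (complex_of (facets ?D - {G}))" if G: "G \<in> S - Fs" for G
  proof -
    have "grafting Fs (S - {G})"
      using grafting_subset[OF less.prems(4), of "S - {G}"] FsS G by auto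
    moreover have "card (S - {G}) < card S"
      using G less.prems(1) by (metis DiffD1 card_Diff1_less)
    ultimately show ?thesis
      using less.hyps[of "S - {G}"] less.prems antichain_subset[of S "S - {G}"] facets by auto
  qed
  have cover: "\<Union>(S - Fs) \<subseteq> \<Union>Fs" using graftingD(2)[OF less.prems(4)] by blast
  have anti: "antichain_sets Fs" "antichain_sets (S - Fs)"
    using FsS antichain_subset[OF less.prems(2)] by simp_all
  have disj: "\<forall>F\<in>Fs. \<forall>F'\<in>Fs. F \<noteq> F' \<longrightarrow> F \<inter> F' = {}"
    using graftingD(3)[OF less.prems(4)] by simp
  show ?case
  proof (rule grafted.intros[OF _ _ anti D cover lv _ disj])
    show "finite Fs" using FsS less.prems(1) by (rule finite_subset)
    show "\<forall>G\<in>S - Fs. (\<exists>F. leaf ?D F \<and> joint_of ?D F G) \<longrightarrow> grafted (complex_of (facets ?D - {G}))"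
      using rec by simp
  qed (use less.prems(1) in auto)
qed

section \<open>Vertex decomposability and dimension\<close>

text \<open>The nonempty traces on \<open>F\<close> form a finite chain; a vertex of the smallest
  one lies in all of them. For a polarization, \<open>(i, 1)\<close> is such a vertex: it divides
  every generator that involves the variable \<open>i\<close>.\<close>

lemma grafting_common_vertex:
  assumes "grafting Fs S" "finite S" "F \<in> Fs" "F \<noteq> {}"
  obtains x where "x \<in> F" "\<And>G. G \<in> S \<Longrightarrow> G \<inter> F \<noteq> {} \<Longrightarrow> x \<in> G"
proof -
  define X where "X = {G \<inter> F | G. G \<in> S \<and> G \<inter> F \<noteq> {}}"
  have "F \<in> X" using graftingD(1)[OF assms(1)] assms(3,4) by (auto simp: X_def)
  moreover have "finite X" using assms(2) by (auto simp: X_def)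
  ultimately obtain T where T: "T \<in> X" "\<And>U. U \<in> X \<Longrightarrow> U \<subseteq> T \<Longrightarrow> U = T"
    using finite_has_minimal[of X] by (metis empty_iff)
  then obtain G0 where G0: "G0 \<in> S" "T = G0 \<inter> F" "T \<noteq> {}" by (auto simp: X_def)
  then obtain x where x: "x \<in> T" by blast
  show ?thesis
  proof (rule that)
    show "x \<in> F" using x G0 by blast
    fix G assume G: "G \<in> S" "G \<inter> F \<noteq> {}"
    then have "G \<inter> F \<in> X" by (auto simp: X_def)
    then show "x \<in> G"
      using T(2)[of "G \<inter> F"] graftingD(4)[OF assms(1,3) G(1) G0(1)] G0(2) x by blast
  qed
qed

text \<open>Removing \<open>x\<close> from the generators can make some of them comparable. This is
  why \<open>indep\<close> is set up for arbitrary families rather than antichains of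
  facets.\<close>

lemma link_indep: "x \<in> V \<Longrightarrow> link (indep V S) x = indep (V - {x}) ((\<lambda>G. G - {x}) ` S)"
  by (auto simp: link_def indep_def)

lemma del_indep: "del (indep V S) x = indep (V - {x}) {G \<in> S. x \<notin> G}"
  by (auto simp: del_def indep_def)

text \<open>The shedding vertex \<open>x\<close> is a vertex of some \<open>F \<in> Fs\<close> lying in all nonempty traces on \<open>F\<close>.
  Deleting it leaves the other vertices of \<open>F\<close> as cone points, so a facet of the deletion that
  could be enlarged by \<open>x\<close> would contain \<open>F\<close>.\<close>

lemma vertex_decomposable_indep:
  assumes "finite V" "S \<subseteq> Pow V" "grafting Fs S"
  shows "vertex_decomposable (indep V S)"
  using assms
proof (induction "card V" arbitrary: V S Fs rule: less_induct)
  case less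
  have finS: "finite S" using less.prems(1,2) by (meson finite_Pow_iff finite_subset)
  note gr = graftingD[OF less.prems(3)]
  show ?case
  proof (cases "{} \<in> S")
    case True
    then have "indep V S = {}" by (auto simp: indep_def)
    then show ?thesis by (simp add: vertex_decomposable.empty)
  next
    case nonempty: False
    define first where
      "first F = (SOME x. x \<in> F \<and> (\<forall>G\<in>S. G \<inter> F \<noteq> {} \<longrightarrow> x \<in> G))" for F
    have first: "first F \<in> F" "\<And>G. G \<in> S \<Longrightarrow> G \<inter> F \<noteq> {} \<Longrightarrow> first F \<in> G" if "F \<in> Fs" for F
    proof -
      have "F \<noteq> {}" using that gr(1) nonempty by blast
      then have "\<exists>x. x \<in> F \<and> (\<forall>G\<in>S. G \<inter> F \<noteq> {} \<longrightarrow> x \<in> G)"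
        using grafting_common_vertex[OF less.prems(3) finS that] by metis
      from someI_ex[OF this] show "first F \<in> F" "\<And>G. G \<in> S \<Longrightarrow> G \<inter> F \<noteq> {} \<Longrightarrow> first F \<in> G"
        by (auto simp: first_def)
    qed
    show ?thesis
    proof (cases "\<forall>F\<in>Fs. {first F} \<in> S")
      case True
      \<comment> \<open>Every generator meets some \<open>F\<close> and therefore contains
        \<open>first F\<close>, whose singleton is itself a generator. Independence then means
        avoiding these points.\<close>
      have "indep V S = Pow (V - first ` Fs)"
      proof (intro equalityI subsetI)
        fix W assume "W \<in> indep V S"
        then show "W \<in> Pow (V - first ` Fs)" using True by (auto simp: indep_def)
      next
        fix W assume W: "W \<in> Pow (V - first ` Fs)"
        have "\<not> G \<subseteq> W" if G: "G \<in> S" for G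
        proof -
          obtain y where "y \<in> G" using G nonempty by (metis ex_in_conv)
          then obtain F where "F \<in> Fs" "G \<inter> F \<noteq> {}" using gr(2) G by blast
          then show ?thesis using first(2) G W by blast
        qed
        then show "W \<in> indep V S" using W by (auto simp: indep_def)
      qed
      then show ?thesis using less.prems(1) by (simp add: vertex_decomposable.simplex)
    next
      case False
      then obtain F where F: "F \<in> Fs" "{first F} \<notin> S" by blast
      define x where "x = first F"
      have xF: "x \<in> F" and xG: "\<And>G. G \<in> S \<Longrightarrow> G \<inter> F \<noteq> {} \<Longrightarrow> x \<in> G"
        using first F(1) by (auto simp: x_def)
      have FV: "F \<subseteq> V" using F gr(1) less.prems(2) by blast
      then have xV: "x \<in> V" using xF by blast
      have card: "card (V - {x}) < card V"
        using xV less.prems(1) by (metis card_Diff1_less)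
      have "{x} \<in> indep V S"
      proof -
        have "\<not> G \<subseteq> {x}" if "G \<in> S" for G
          using that nonempty F(2) by (auto simp: x_def subset_singleton_iff)
        then show ?thesis using xV by (auto simp: indep_def)
      qed
      moreover have "vertex_decomposable (link (indep V S) x)"
        unfolding link_indep[OF xV]
      proof (rule less.hyps[OF card])
        show "grafting ((\<lambda>G. G - {x}) ` Fs) ((\<lambda>G. G - {x}) ` S)"
          unfolding grafting_def
        proof (intro conjI ballI impI)
          show "(\<lambda>G. G - {x}) ` Fs \<subseteq> (\<lambda>G. G - {x}) ` S" using gr(1) by blast
          show "\<Union>((\<lambda>G. G - {x}) ` S) \<subseteq> \<Union>((\<lambda>G. G - {x}) ` Fs)" using gr(2) by blast
          fix A B assume "A \<in> (\<lambda>G. G - {x}) ` Fs" "B \<in> (\<lambda>G. G - {x}) ` Fs" "A \<noteq> B"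
          then obtain A' B' where "A' \<in> Fs" "B' \<in> Fs" "A = A' - {x}" "B = B' - {x}" "A' \<noteq> B'"
            by auto
          then show "A \<inter> B = {}" using gr(3)[of A' B'] by blast
        next
          fix F' G H 
          assume "F' \<in> (\<lambda>G. G - {x}) ` Fs" "G \<in> (\<lambda>G. G - {x}) ` S" "H \<in> (\<lambda>G. G - {x}) ` S"
          then obtain F0 G0 H0 where "F0 \<in> Fs" "G0 \<in> S" "H0 \<in> S" 
            "F' = F0 - {x}" "G = G0 - {x}" "H = H0 - {x}" by blast
          then show "G \<inter> F' \<subseteq> H \<inter> F' \<or> H \<inter> F' \<subseteq> G \<inter> F'" using gr(4)[of F0 G0 H0] by blast
        qed
      qed (use less.prems in auto)
      moreover have "vertex_decomposable (del (indep V S) x)"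
        unfolding del_indep
      proof (rule less.hyps[OF card])
        \<comment> \<open>A generator that misses \<open>x\<close> misses all of \<open>F\<close>,
          by the choice of \<open>x\<close>. The points of \<open>F - {x}\<close> remain in the
          vertex set without being covered, a situation that the induction statement
          permits.\<close>
        show "grafting (Fs - {F}) {G \<in> S. x \<notin> G}"
          unfolding grafting_def
        proof (intro conjI ballI impI)
          show "Fs - {F} \<subseteq> {G \<in> S. x \<notin> G}" using gr(1) gr(3)[OF F(1)] xF by blast
          show "\<Union>{G \<in> S. x \<notin> G} \<subseteq> \<Union>(Fs - {F})" using gr(2) xG by blast
        qed (use gr(3,4) in auto)
      qed (use less.prems in auto)
      moreover have "facets (del (indep V S) x) \<subseteq> facets (indep V S)"
      proof
        fix W assume W: "W \<in> facets (del (indep V S) x)"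
        then have W1: "W \<in> indep V S" "x \<notin> W" by (auto simp: facets_def del_def)
        \<comment> \<open>A generator inside \<open>insert y W\<close> would contain
          \<open>y\<close> because \<open>W\<close> is independent; it would then meet
          \<open>F\<close> and contain \<open>x\<close>, which is neither \<open>y\<close> nor in
          \<open>W\<close>. So maximality of \<open>W\<close> in the deletion forces
          \<open>y\<close> into it.\<close>
        have "y \<in> W" if y: "y \<in> F" "y \<noteq> x" for y
        proof -
          have "\<not> G \<subseteq> insert y W" if "G \<in> S" for G
          proof
            assume "G \<subseteq> insert y W"
            moreover from this have "y \<in> G" using W1 that by (auto simp: indep_def)
            ultimately show False using xG[OF that] y W1(2) by blast
          qed
          then have "insert y W \<in> del (indep V S) x"
            using W1 y FV by (auto simp: del_def indep_def)
          then show "y \<in> W" using W by (auto simp: facets_def)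
        qed
        then have "F \<subseteq> insert x W" by blast
        then have "U = W" if U: "U \<in> indep V S" "W \<subseteq> U" for U
        proof -
          have "x \<notin> U" 
          proof
            assume "x \<in> U"
            then have "F \<subseteq> U" using U \<open>F \<subseteq> insert x W\<close> by blast
            then show False using U(1) F(1) gr(1) by (auto simp: indep_def)
          qed
          then show ?thesis using W U by (auto simp: facets_def del_def)
        qed
        then show "W \<in> facets (indep V S)" using W1 by (auto simp: facets_def)
      qed
      ultimately show ?thesis using vertex_decomposable.shed[of x "indep V S"] by simp
    qed
  qed
qed

text \<open>An independent set omits a point of each of the disjoint members of \<open>Fs\<close>,
  which bounds its size. Omitting exactly one common vertex per member already hits every generator,
  so the bound is attained.\<close>

lemma dim_indep:
  assumes "finite V" "S \<subseteq> Pow V" "grafting Fs S" "{} \<notin> S" "\<Union>Fs = V"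
  shows "dim_complex (indep V S) = int (card V) - int (card Fs) - 1"
proof -
  have finS: "finite S" using assms(1,2) by (meson finite_Pow_iff finite_subset)
  note gr = graftingD[OF assms(3)]
  have finFs: "finite Fs" using finS gr(1) finite_subset by blast
  have inj: "inj_on g Fs" if "\<And>F. F \<in> Fs \<Longrightarrow> g F \<in> F" for g
    using gr(3) that by (intro inj_onI) (metis disjoint_iff)
  have Fs_le: "card Fs \<le> card (V - W)" if W: "W \<in> indep V S" for W
  proof -
    have "\<forall>F\<in>Fs. \<exists>y. y \<in> F \<and> y \<notin> W" using W gr(1) by (auto simp: indep_def)
    then obtain g where g: "\<And>F. F \<in> Fs \<Longrightarrow> g F \<in> F \<and> g F \<notin> W" by metis
    have "card Fs = card (g ` Fs)" using inj g by (simp add: card_image)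
    also have "\<dots> \<le> card (V - W)"
      using g assms(1,5) by (intro card_mono) auto
    finally show ?thesis .
  qed
  have upper: "card W \<le> card V - card Fs" if "W \<in> indep V S" for W
    using Fs_le[OF that] that assms(1) card_mono[of V W]
    by (auto simp: indep_def card_Diff_subset finite_subset)
  have "\<forall>F\<in>Fs. \<exists>x. x \<in> F \<and> (\<forall>G\<in>S. G \<inter> F \<noteq> {} \<longrightarrow> x \<in> G)"
    using grafting_common_vertex[OF assms(3) finS] gr(1) assms(4) by (metis subsetD)
  then obtain first where first: "\<And>F. F \<in> Fs \<Longrightarrow> first F \<in> F"
    "\<And>F G. F \<in> Fs \<Longrightarrow> G \<in> S \<Longrightarrow> G \<inter> F \<noteq> {} \<Longrightarrow> first F \<in> G" by metis
  let ?W = "V - first ` Fs"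
  have "\<not> G \<subseteq> ?W" if G: "G \<in> S" for G
  proof -
    obtain y where "y \<in> G" using G assms(4) by (metis ex_in_conv)
    then obtain F where "F \<in> Fs" "G \<inter> F \<noteq> {}" using gr(2) G by blast
    then show ?thesis using first(2) G by blast
  qed
  then have W: "?W \<in> indep V S" by (auto simp: indep_def)
  have sub: "first ` Fs \<subseteq> V" using first(1) assms(5) by blast
  have cardW: "card ?W = card V - card Fs"
    using sub finFs by (simp add: card_Diff_subset card_image inj first(1))
  have "card Fs \<le> card V" using Fs_le[OF W] sub assms(1) by (meson card_mono Diff_subset le_trans)
  moreover have "Max (card ` indep V S) = card V - card Fs"
  proof (rule Max_eqI)
    show "finite (card ` indep V S)" using assms(1)
      by (intro finite_imageI finite_subset[of "indep V S" "Pow V"]) (auto simp: indep_def)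
    show "card V - card Fs \<in> card ` indep V S" using W cardW by (metis image_eqI)
  qed (use upper in auto)
  ultimately show ?thesis by (simp add: dim_complex_def of_nat_diff)
qed

section \<open>Monomial ideals\<close>

abbreviation keys where "keys \<equiv> Poly_Mapping.keys"
abbreviation lookup where "lookup \<equiv> Poly_Mapping.lookup"

definition mdvd :: "('x \<Rightarrow>\<^sub>0 nat) \<Rightarrow> ('x \<Rightarrow>\<^sub>0 nat) \<Rightarrow> bool" where
  "mdvd s t \<longleftrightarrow> (\<forall>x. lookup s x \<le> lookup t x)"

lemma mdvd_refl: "mdvd t t"
  by (simp add: mdvd_def)

lemma mdvd_trans: "mdvd r s \<Longrightarrow> mdvd s t \<Longrightarrow> mdvd r t"
  unfolding mdvd_def using order_trans by blast

lemma mdvd_add: "mdvd s t \<Longrightarrow> mdvd s (u + t)"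
  by (simp add: mdvd_def lookup_add trans_le_add2)

lemma mdvd_diff_add: "mdvd s t \<Longrightarrow> (t - s) + s = t"
  by (intro poly_mapping_eqI) (simp add: mdvd_def lookup_add lookup_minus)

definition upset :: "'x set \<Rightarrow> ('x \<Rightarrow>\<^sub>0 nat) set \<Rightarrow> ('x \<Rightarrow>\<^sub>0 nat) set" where
  "upset X M = {t \<in> mons_on X. \<exists>m\<in>M. mdvd m t}"

lemma upset_self: "M \<subseteq> mons_on X \<Longrightarrow> t \<in> M \<Longrightarrow> t \<in> upset X M"
  using mdvd_refl by (auto simp: upset_def)

lemma mons_on_add: "s \<in> mons_on X \<Longrightarrow> t \<in> mons_on X \<Longrightarrow> s + t \<in> mons_on X"
  using keys_add[of s t] by (auto simp: mons_on_def)

lemma mons_on_diff: "t \<in> mons_on X \<Longrightarrow> t - s \<in> mons_on X" for t s :: "'x \<Rightarrow>\<^sub>0 nat"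
  by (auto simp: mons_on_def in_keys_iff lookup_minus)

lemma ideal_upset:
  "ideal {p :: ('x, 'k::field) mpoly. keys p \<subseteq> upset X M} (poly_ring X)"
  (is "ideal ?I ?R")
proof -
  interpret cring ?R by (rule cring_poly_ring)
  have carr: "carrier ?R = {p. keys p \<subseteq> mons_on X}" by (simp add: poly_ring_def)
  have mult: "q * p \<in> ?I" if "keys q \<subseteq> mons_on X" "p \<in> ?I" for p q :: "('x, 'k) mpoly"
  proof -
    have "keys (q * p) \<subseteq> {a + b | a b. a \<in> keys q \<and> b \<in> keys p}" by (rule keys_mult)
    also have "\<dots> \<subseteq> upset X M"
    proof clarify
      fix a b assume "a \<in> keys q" "b \<in> keys p"
      then have "a \<in> mons_on X" "b \<in> upset X M" using that by auto
      then show "a + b \<in> upset X M" using mons_on_add[of a X b] mdvd_add by (auto simp: upset_def)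
    qed
    finally show ?thesis by simp
  qed
  show ?thesis
  proof (rule idealI)
    show "ring ?R" by (rule ring_axioms)
    show "subgroup ?I (add_monoid ?R)"
    proof (rule subgroup.intro)
      show "?I \<subseteq> carrier (add_monoid ?R)" by (auto simp: poly_ring_def upset_def)
      fix p q assume pq: "p \<in> ?I" "q \<in> ?I"
      then show "p \<otimes>\<^bsub>add_monoid ?R\<^esub> q \<in> ?I"
        using keys_add[of p q] by (auto simp: poly_ring_def)
    next
      show "\<one>\<^bsub>add_monoid ?R\<^esub> \<in> ?I" by (simp add: poly_ring_def)
    next
      fix p :: "('x, 'k) mpoly" assume p: "p \<in> ?I"
      have "\<ominus>\<^bsub>?R\<^esub> p = - p"
        by (rule minus_equality) (use p in \<open>auto simp: poly_ring_def upset_def\<close>)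
      then show "inv\<^bsub>add_monoid ?R\<^esub> p \<in> ?I" using p by (simp add: a_inv_def)
    qed
  next
    fix p q assume "p \<in> ?I" "q \<in> carrier ?R"
    then show "q \<otimes>\<^bsub>?R\<^esub> p \<in> ?I" "p \<otimes>\<^bsub>?R\<^esub> q \<in> ?I"
      using mult[of q p] carr by (simp_all add: poly_ring_def mult.commute)
  qed
qed

lemma keys_mon: "keys (mon t :: ('x, 'k::field) mpoly) = {t}"
  by (simp add: mon_def)

text \<open>A polynomial is the sum of its terms, and a term whose monomial is divisible by a
  generator is a multiple of that generator. From here on monomial ideals are handled as sets of
  exponent vectors.\<close>

lemma Idl_mon:
  assumes "M \<subseteq> mons_on X"
  shows "Idl\<^bsub>poly_ring X\<^esub> (mon ` M) = {p :: ('x, 'k::field) mpoly. keys p \<subseteq> upset X M}"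
    (is "?L = ?I")
proof
  let ?R = "poly_ring X :: ('x, 'k) mpoly ring"
  interpret cring ?R by (rule cring_poly_ring)
  have "mon ` M \<subseteq> ?I" using upset_self[OF assms] by (auto simp: keys_mon)
  then show "?L \<subseteq> ?I" by (rule genideal_minimal[OF ideal_upset])
  have carr: "mon ` M \<subseteq> carrier ?R" using assms by (auto simp: poly_ring_def keys_mon)
  interpret L: ideal ?L ?R by (rule genideal_ideal[OF carr])
  have single: "Poly_Mapping.single t c \<in> ?L" if t: "t \<in> upset X M" for t c
  proof -
    obtain m where m: "m \<in> M" "mdvd m t" using t by (auto simp: upset_def)
    have "Poly_Mapping.single (t - m) c \<otimes>\<^bsub>?R\<^esub> mon m \<in> ?L"
    proof (rule L.I_l_closed)
      show "mon m \<in> ?L" using genideal_self[OF carr] m(1) by blast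
      show "Poly_Mapping.single (t - m) c \<in> carrier ?R"
        using t mons_on_diff[of t X m] by (simp add: poly_ring_def upset_def)
    qed
    then show ?thesis using m by (simp add: poly_ring_def mon_def mult_single mdvd_diff_add)
  qed
  have step: "p \<in> ?L" if "finite K" "K \<subseteq> upset X M" "keys p \<subseteq> K" for p K
    using that
  proof (induction K arbitrary: p rule: finite_induct)
    case empty
    then show ?case using L.zero_closed by (simp add: poly_ring_def)
  next
    case (insert t K)
    let ?s = "Poly_Mapping.single t (lookup p t)"
    have "keys (p - ?s) \<subseteq> K"
      using insert.prems(2) by (auto simp: in_keys_iff lookup_minus lookup_single when_def split: if_splits)
    then have "p - ?s \<in> ?L" using insert by auto
    moreover have "?s \<in> ?L" using single insert.prems by auto
    ultimately have "(p - ?s) \<oplus>\<^bsub>?R\<^esub> ?s \<in> ?L" by (rule L.a_closed)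
    then show ?case by (simp add: poly_ring_def)
  qed
  show "?I \<subseteq> ?L" using step[OF finite_keys _ order_refl] by (simp add: subset_iff)
qed

lemma upset_eqD:
  assumes "{p :: ('x, 'k::field) mpoly. keys p \<subseteq> upset X M} = {p. keys p \<subseteq> upset X N}"
  shows "upset X M = upset X N"
proof -
  have "(t \<in> upset X M) = (t \<in> upset X N)" for t
    using arg_cong[OF assms, of "\<lambda>I. mon t \<in> I"] by (simp add: keys_mon)
  then show ?thesis by blast
qed

text \<open>An antichain for divisibility consists of the minimal elements of the set it generates.
  This yields uniqueness of the minimal generators.\<close>

lemma upset_antichain_eqD:
  assumes "\<forall>s\<in>M. \<forall>t\<in>M. mdvd s t \<longrightarrow> s = t" "\<forall>s\<in>N. \<forall>t\<in>N. mdvd s t \<longrightarrow> s = t"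
    and "M \<subseteq> mons_on X" "N \<subseteq> mons_on X" "upset X M = upset X N"
  shows "M = N"
proof -
  have "A \<subseteq> B" if A: "\<forall>s\<in>A. \<forall>t\<in>A. mdvd s t \<longrightarrow> s = t" "A \<subseteq> mons_on X" and B: "B \<subseteq> mons_on X"
    and eq: "upset X A = upset X B" for A B :: "('a \<Rightarrow>\<^sub>0 nat) set"
  proof
    fix t assume t: "t \<in> A"
    then have "t \<in> upset X B" using upset_self[OF A(2)] eq by simp
    then obtain s where s: "s \<in> B" "mdvd s t" by (auto simp: upset_def)
    then have "s \<in> upset X A" using upset_self[OF B] eq by simp
    then obtain r where r: "r \<in> A" "mdvd r s" by (auto simp: upset_def)
    then have "r = t" using A(1) t mdvd_trans s(2) by blast
    then have "s = t" using r(2) s(2) by (intro poly_mapping_eqI) (simp add: mdvd_def le_antisym)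
    then show "t \<in> B" using s by simp
  qed
  from this[of M N] this[of N M] assms show ?thesis by auto
qed

text \<open>A generator is redundant exactly when a different generator divides it, so irredundancy
  is the antichain condition.\<close>

lemma minimally_generates_iff:
  fixes J :: "('x, 'k::field) mpoly set"
  shows "minimally_generates X M J \<longleftrightarrow> M \<subseteq> mons_on X \<and> (\<forall>s\<in>M. \<forall>t\<in>M. mdvd s t \<longrightarrow> s = t) \<and>
     J = {p. keys p \<subseteq> upset X M}" (is "?L \<longleftrightarrow> ?R")
proof
  assume L: ?L
  then have M: "M \<subseteq> mons_on X" and J: "J = {p. keys p \<subseteq> upset X M}"
    using Idl_mon[of M X, where ?'k = 'k] by (auto simp: minimally_generates_def)
  have "s = t" if st: "s \<in> M" "t \<in> M" "mdvd s t" for s t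
  proof (rule ccontr)
    assume ne: "s \<noteq> t"
    have "upset X (M - {t}) = upset X M"
    proof
      show "upset X (M - {t}) \<subseteq> upset X M" by (auto simp: upset_def)
      show "upset X M \<subseteq> upset X (M - {t})"
      proof
        fix u assume "u \<in> upset X M"
        then obtain m where m: "m \<in> M" "mdvd m u" "u \<in> mons_on X" by (auto simp: upset_def)
        then show "u \<in> upset X (M - {t})"
          using st ne mdvd_trans[of s t u] unfolding upset_def by (cases "m = t") auto
      qed
    qed
    moreover have "M - {t} \<subset> M" "M - {t} \<subseteq> mons_on X" using st M by auto
    ultimately show False
      using L J Idl_mon[of "M - {t}" X, where ?'k = 'k] by (auto simp: minimally_generates_def)
  qed
  then show ?R using M J by blast
next
  assume R: ?R
  have "Idl\<^bsub>poly_ring X\<^esub> (mon ` M') \<noteq> J" if M': "M' \<subset> M" for M'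
  proof
    assume eq: "Idl\<^bsub>poly_ring X\<^esub> (mon ` M') = J"
    have "M' \<subseteq> mons_on X" using M' R by blast
    then have "{p :: ('x, 'k) mpoly. keys p \<subseteq> upset X M'} = {p. keys p \<subseteq> upset X M}"
      using eq R Idl_mon[of M' X, where ?'k = 'k] by simp
    then have ups: "upset X M' = upset X M" by (rule upset_eqD)
    obtain t where t: "t \<in> M" "t \<notin> M'" using M' by blast
    then have "t \<in> upset X M'" using R upset_self[of M X] ups by simp
    then obtain s where "s \<in> M'" "mdvd s t" by (auto simp: upset_def)
    then show False using R t M' by blast
  qed
  then show ?L using R Idl_mon[of M X, where ?'k = 'k] by (auto simp: minimally_generates_def)
qed

lemma min_gens_eq:
  fixes J :: "('x, 'k::field) mpoly set"
  assumes "minimally_generates X M J"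
  shows "min_gens X J = M"
  unfolding min_gens_def
proof (rule the_equality[where P = "\<lambda>M. minimally_generates X M J", OF assms])
  fix N assume "minimally_generates X N J"
  then show "N = M"
    using assms unfolding minimally_generates_iff
    by (metis upset_antichain_eqD upset_eqD)
qed

lemma minimally_generates_min_gens:
  fixes J :: "('x, 'k::field) mpoly set"
  assumes "monomial_ideal X J"
  shows "minimally_generates X (min_gens X J) J"
proof -
  obtain N where N: "N \<subseteq> mons_on X" "J = Idl\<^bsub>poly_ring X\<^esub> (mon ` N)"
    using assms by (auto simp: monomial_ideal_def)
  define M where "M = {t \<in> N. \<forall>s\<in>N. mdvd s t \<longrightarrow> s = t}"
  \<comment> \<open>Total degree decreases strictly under proper divisibility, so every member of a
    possibly infinite generating set has a minimal divisor in that set.\<close>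
  define deg :: "('x \<Rightarrow>\<^sub>0 nat) \<Rightarrow> nat" where "deg t = (\<Sum>x\<in>keys t. lookup t x)" for t
  have deg_less: "deg s < deg t" if dv: "mdvd s t" "s \<noteq> t" for s t
  proof -
    have "keys s \<subseteq> keys t" using dv(1) unfolding mdvd_def in_keys_iff subset_iff by (metis le_zero_eq)
    then have "deg s = (\<Sum>x\<in>keys t. lookup s x)"
      unfolding deg_def by (intro sum.mono_neutral_left) (auto simp: in_keys_iff)
    also have "\<dots> < deg t" unfolding deg_def
    proof (rule sum_strict_mono_ex1)
      show "\<forall>x\<in>keys t. lookup s x \<le> lookup t x" using dv(1) by (simp add: mdvd_def)
      obtain x where x: "lookup s x \<noteq> lookup t x" using dv(2) poly_mapping_eqI by metis
      then have "lookup s x < lookup t x" using dv(1) by (simp add: mdvd_def order_less_le)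
      then show "\<exists>x\<in>keys t. lookup s x < lookup t x"
        by (intro bexI[of _ x]) (auto simp: in_keys_iff)
    qed simp
    finally show ?thesis .
  qed
  have below: "\<exists>m\<in>M. mdvd m t" if t: "t \<in> N" for t
  proof -
    obtain m where m: "m \<in> N" "mdvd m t" "\<And>s. s \<in> N \<Longrightarrow> mdvd s t \<Longrightarrow> deg m \<le> deg s"
      using ex_has_least_nat[of "\<lambda>s. s \<in> N \<and> mdvd s t" t deg] t mdvd_refl by blast
    then have "m \<in> M" unfolding M_def
      using deg_less mdvd_trans by (fastforce simp: not_less[symmetric])
    then show ?thesis using m by blast
  qed
  have "upset X M = upset X N"
  proof
    show "upset X M \<subseteq> upset X N" by (auto simp: upset_def M_def)
    show "upset X N \<subseteq> upset X M" using below mdvd_trans unfolding upset_def by blast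
  qed
  then have "minimally_generates X M J"
    unfolding minimally_generates_iff using N Idl_mon[of N X, where ?'k = 'k] by (auto simp: M_def)
  then show ?thesis using min_gens_eq by metis
qed

section \<open>Square-free monomial ideals and polarization\<close>

definition sqfree :: "'x set \<Rightarrow> ('x \<Rightarrow>\<^sub>0 nat)" where
  "sqfree W = (\<Sum>x\<in>W. Poly_Mapping.single x 1)"

lemma lookup_sqfree: "finite W \<Longrightarrow> lookup (sqfree W) x = (if x \<in> W then 1 else 0)"
  by (simp add: sqfree_def lookup_sum lookup_single when_def)

lemma keys_sqfree: "finite W \<Longrightarrow> keys (sqfree W) = W"
  by (rule Set.set_eqI) (simp add: in_keys_iff lookup_sqfree)

lemma mdvd_sqfree:
  assumes "finite W"
  shows "mdvd (sqfree W) t \<longleftrightarrow> W \<subseteq> keys t"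
proof -
  have "(if x \<in> W then 1 else 0) \<le> lookup t x \<longleftrightarrow> (x \<in> W \<longrightarrow> x \<in> keys t)" for x
    by (simp add: in_keys_iff Suc_le_eq)
  then show ?thesis by (simp add: mdvd_def lookup_sqfree[OF assms] subset_iff)
qed

lemma prod_pvar: "(\<Prod>x\<in>W. pvar x) = (mon (sqfree W) :: ('x, 'k::field) mpoly)"
proof (induction W rule: infinite_finite_induct)
  case (insert x W)
  then show ?case by (simp add: sqfree_def pvar_def mon_def mult_single)
qed (simp_all add: sqfree_def mon_def)

definition sqfree_ideal :: "'x set \<Rightarrow> 'x set set \<Rightarrow> ('x, 'k::field) mpoly set" where
  "sqfree_ideal V S = {p. \<forall>t\<in>keys p. t \<in> mons_on V \<and> (\<exists>F\<in>S. F \<subseteq> keys t)}"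

lemma Idl_sqfree:
  assumes "finite V" "S \<subseteq> Pow V"
  shows "Idl\<^bsub>poly_ring V\<^esub> {\<Prod>x\<in>F. pvar x | F. F \<in> S} = (sqfree_ideal V S :: ('x, 'k::field) mpoly set)"
proof -
  have fin: "finite F" if "F \<in> S" for F using that assms finite_subset by blast
  have "{\<Prod>x\<in>F. pvar x | F. F \<in> S} = (mon ` (sqfree ` S) :: ('x, 'k) mpoly set)"
    by (auto simp: prod_pvar)
  moreover have "sqfree ` S \<subseteq> mons_on V"
    using assms(2) fin keys_sqfree by (fastforce simp: mons_on_def)
  moreover have "upset V (sqfree ` S) = {t \<in> mons_on V. \<exists>F\<in>S. F \<subseteq> keys t}"
    using fin by (auto simp: upset_def mdvd_sqfree)
  ultimately show ?thesis by (auto simp: Idl_mon sqfree_ideal_def)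
qed

lemma SR_complex_sqfree:
  assumes "finite V"
  shows "SR_complex V (sqfree_ideal V S :: ('x, 'k::field) mpoly set) = indep V S"
proof -
  have "((\<Prod>x\<in>W. pvar x) \<in> (sqfree_ideal V S :: ('x, 'k) mpoly set)) \<longleftrightarrow> (\<exists>F\<in>S. F \<subseteq> W)"
    if "W \<subseteq> V" for W
  proof -
    have "finite W" using that assms finite_subset by blast
    then show ?thesis using that by (simp add: prod_pvar sqfree_ideal_def keys_mon mons_on_def keys_sqfree)
  qed
  then show ?thesis by (auto simp: SR_complex_def indep_def)
qed

lemma facet_ideal_eq:
  assumes "finite V" "D \<subseteq> Pow V"
  shows "facet_ideal V D = sqfree_ideal V (facets D)"
  unfolding facet_ideal_def using assms facets_subset by (intro Idl_sqfree) blast+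

text \<open>Non-faces are the supersets of generators, so both families of square-free monomials
  generate the same ideal. For \<open>S = facets D\<close> this is the equality of the facet ideal
  of \<open>D\<close> with the Stanley-Reisner ideal of its independence complex.\<close>

lemma SR_ideal_indep:
  assumes "finite V" "S \<subseteq> Pow V"
  shows "SR_ideal V (indep V S) = sqfree_ideal V S"
proof -
  have "SR_ideal V (indep V S) = sqfree_ideal V {W. W \<subseteq> V \<and> W \<notin> indep V S}"
    unfolding SR_ideal_def using Idl_sqfree[OF assms(1), of "{W. W \<subseteq> V \<and> W \<notin> indep V S}"] by auto
  moreover have "(\<exists>F\<in>{W. W \<subseteq> V \<and> W \<notin> indep V S}. F \<subseteq> A) \<longleftrightarrow> (\<exists>F\<in>S. F \<subseteq> A)" for A
    using assms(2) unfolding indep_def by blast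
  ultimately show ?thesis by (simp add: sqfree_ideal_def)
qed

text \<open>The support of the polarized monomial, which is square-free and hence determined by
  it.\<close>

definition polset :: "('x \<Rightarrow>\<^sub>0 nat) \<Rightarrow> ('x \<times> nat) set" where
  "polset t = {(i, j). 1 \<le> j \<and> j \<le> lookup t i}"

lemma polset_Sigma: "polset t = Sigma (keys t) (\<lambda>i. {1..lookup t i})"
  by (auto simp: polset_def in_keys_iff)

text \<open>Over each variable the set is an initial segment whose length is the exponent, so
  inclusion compares exponents. Minimal generators thereby become an antichain of sets.\<close>

lemma polset_subset_iff: "polset s \<subseteq> polset t \<longleftrightarrow> mdvd s t"
proof
  assume sub: "polset s \<subseteq> polset t"
  show "mdvd s t" unfolding mdvd_def
  proof
    fix x show "lookup s x \<le> lookup t x"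
    proof (cases "lookup s x = 0")
      case False
      then have "(x, lookup s x) \<in> polset s" by (simp add: polset_def)
      then show ?thesis using sub by (auto simp: polset_def)
    qed simp
  qed
qed (auto simp: polset_def mdvd_def intro: order_trans)

lemma pol_mon_eq: "pol_mon t = (mon (sqfree (polset t)) :: ('x \<times> nat, 'k::field) mpoly)"
  unfolding pol_mon_def prod_pvar[symmetric] polset_Sigma by (simp add: prod.Sigma case_prod_beta)

lemma pol_vars_eq: "pol_vars X J = \<Union>(polset ` min_gens X J)"
  by (auto simp: pol_vars_def polset_def)

lemma polarization_eq:
  assumes "finite (pol_vars X J)"
  shows "polarization X J = sqfree_ideal (pol_vars X J) (polset ` min_gens X J)"
proof -
  have "pol_mon ` min_gens X J =
    ({\<Prod>x\<in>F. pvar x | F. F \<in> polset ` min_gens X J} :: ('a \<times> nat, 'b) mpoly set)"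
    by (auto simp: pol_mon_eq prod_pvar)
  moreover have "polset ` min_gens X J \<subseteq> Pow (pol_vars X J)" by (auto simp: pol_vars_eq)
  ultimately show ?thesis
    unfolding polarization_def using Idl_sqfree[OF assms] by simp
qed

text \<open>Both \<^const>\<open>rename_mon\<close> and \<^const>\<open>rename_poly\<close> move a finitely supported function along a
  map of its domain.\<close>

definition push :: "('a \<Rightarrow> 'b) \<Rightarrow> ('a \<Rightarrow>\<^sub>0 'c::comm_monoid_add) \<Rightarrow> ('b \<Rightarrow>\<^sub>0 'c)" where
  "push \<sigma> t = (\<Sum>x\<in>keys t. Poly_Mapping.single (\<sigma> x) (lookup t x))"

lemma rename_mon_push: "rename_mon \<sigma> = push \<sigma>"
  by (simp add: fun_eq_iff rename_mon_def push_def)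

lemma rename_poly_push: "rename_poly \<sigma> = push (rename_mon \<sigma>)"
  by (simp add: fun_eq_iff rename_poly_def push_def)

lemma lookup_push: "lookup (push \<sigma> t) y = (\<Sum>x\<in>keys t. lookup t x when \<sigma> x = y)"
  by (simp add: push_def lookup_sum lookup_single)

lemma lookup_push_inj:
  assumes "inj_on \<sigma> (keys t)" "x \<in> keys t"
  shows "lookup (push \<sigma> t) (\<sigma> x) = lookup t x"
proof -
  have "(\<Sum>z\<in>keys t. lookup t z when \<sigma> z = \<sigma> x) = (\<Sum>z\<in>keys t. if z = x then lookup t z else 0)"
    by (intro sum.cong) (use assms in \<open>auto simp: when_def inj_on_def\<close>)
  then show ?thesis using assms(2) by (simp add: lookup_push)
qed

lemma keys_push:
  assumes "inj_on \<sigma> (keys t)"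
  shows "keys (push \<sigma> t) = \<sigma> ` keys t"
proof
  show "keys (push \<sigma> t) \<subseteq> \<sigma> ` keys t"
  proof
    fix y assume "y \<in> keys (push \<sigma> t)"
    then have "(\<Sum>x\<in>keys t. lookup t x when \<sigma> x = y) \<noteq> 0" by (simp add: in_keys_iff lookup_push)
    then obtain x where "x \<in> keys t" "(lookup t x when \<sigma> x = y) \<noteq> 0"
      by (rule sum.not_neutral_contains_not_neutral)
    then show "y \<in> \<sigma> ` keys t" by auto
  qed
  show "\<sigma> ` keys t \<subseteq> keys (push \<sigma> t)"
    using lookup_push_inj[OF assms] by (auto simp: in_keys_iff)
qed

lemma push_push:
  assumes "\<And>x. x \<in> keys t \<Longrightarrow> \<tau> (\<sigma> x) = x"
  shows "push \<tau> (push \<sigma> t) = t"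
proof (rule poly_mapping_eqI)
  fix y
  have inj: "inj_on \<sigma> (keys t)" using assms by (rule inj_on_inverseI)
  have "lookup (push \<tau> (push \<sigma> t)) y = (\<Sum>z\<in>\<sigma> ` keys t. lookup (push \<sigma> t) z when \<tau> z = y)"
    by (simp add: lookup_push[of \<tau>] keys_push[OF inj])
  also have "\<dots> = (\<Sum>x\<in>keys t. lookup t x when x = y)"
    unfolding sum.reindex[OF inj] comp_def
    by (intro sum.cong) (simp_all add: lookup_push_inj[OF inj] assms)
  also have "\<dots> = lookup t y" by (simp add: when_def in_keys_iff)
  finally show "lookup (push \<tau> (push \<sigma> t)) y = lookup t y" .
qed

lemma rename_mon_inverse:
  assumes "t \<in> mons_on U" "\<And>x. x \<in> U \<Longrightarrow> \<tau> (\<sigma> x) = x"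
  shows "rename_mon \<tau> (rename_mon \<sigma> t) = t"
  unfolding rename_mon_push by (rule push_push) (use assms in \<open>auto simp: mons_on_def\<close>)

lemma rename_poly_inverse:
  assumes "p \<in> sqfree_ideal U S" "\<And>x. x \<in> U \<Longrightarrow> \<tau> (\<sigma> x) = x"
  shows "rename_poly \<tau> (rename_poly \<sigma> p) = p"
  unfolding rename_poly_push
proof (rule push_push)
  fix t assume "t \<in> keys p"
  then have "t \<in> mons_on U" using assms(1) by (auto simp: sqfree_ideal_def)
  then show "rename_mon \<tau> (rename_mon \<sigma> t) = t" using assms(2) by (rule rename_mon_inverse)
qed

lemma rename_poly_sqfree_ideal:
  assumes p: "p \<in> sqfree_ideal U S" and \<sigma>: "bij_betw \<sigma> U V"
  shows "rename_poly \<sigma> p \<in> sqfree_ideal V (image \<sigma> ` S)"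
proof -
  have inv: "inv_into U \<sigma> (\<sigma> x) = x" if "x \<in> U" for x
    using \<sigma> that by (rule bij_betw_inv_into_left)
  have pU: "t \<in> mons_on U" if "t \<in> keys p" for t using p that by (auto simp: sqfree_ideal_def)
  have "inj_on (rename_mon \<sigma>) (keys p)"
  proof (rule inj_on_inverseI[where g = "rename_mon (inv_into U \<sigma>)"])
    fix t assume "t \<in> keys p"
    from pU[OF this] inv show "rename_mon (inv_into U \<sigma>) (rename_mon \<sigma> t) = t"
      by (rule rename_mon_inverse)
  qed
  then have kp: "keys (rename_poly \<sigma> p) = rename_mon \<sigma> ` keys p"
    unfolding rename_poly_push by (rule keys_push)
  have kt: "keys (rename_mon \<sigma> t) = \<sigma> ` keys t" if "t \<in> keys p" for t
    unfolding rename_mon_push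
  proof (rule keys_push)
    show "inj_on \<sigma> (keys t)"
      using pU[OF that] \<sigma> by (auto simp: mons_on_def bij_betw_def intro: inj_on_subset)
  qed
  have "rename_mon \<sigma> t \<in> mons_on V \<and> (\<exists>F\<in>image \<sigma> ` S. F \<subseteq> keys (rename_mon \<sigma> t))"
    if t: "t \<in> keys p" for t
  proof
    show "rename_mon \<sigma> t \<in> mons_on V"
      using kt[OF t] pU[OF t] \<sigma> by (auto simp: mons_on_def bij_betw_def)
    obtain F where "F \<in> S" "F \<subseteq> keys t" using p t by (auto simp: sqfree_ideal_def)
    then show "\<exists>F\<in>image \<sigma> ` S. F \<subseteq> keys (rename_mon \<sigma> t)"
      using kt[OF t] by auto
  qed
  then show ?thesis by (simp add: sqfree_ideal_def kp)
qed

lemma rename_sqfree_ideal: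
  assumes "bij_betw \<sigma> U V" "S \<subseteq> Pow U"
  shows "rename_poly \<sigma> ` sqfree_ideal U S = sqfree_ideal V (image \<sigma> ` S)"
proof (intro equalityI subsetI)
  fix q assume "q \<in> rename_poly \<sigma> ` sqfree_ideal U S"
  then show "q \<in> sqfree_ideal V (image \<sigma> ` S)" using rename_poly_sqfree_ideal assms(1) by auto
next
  fix q assume q: "q \<in> sqfree_ideal V (image \<sigma> ` S)"
  let ?\<tau> = "inv_into U \<sigma>"
  have "rename_poly \<sigma> (rename_poly ?\<tau> q) = q"
    using q by (rule rename_poly_inverse) (rule bij_betw_inv_into_right[OF assms(1)])
  moreover have "rename_poly ?\<tau> q \<in> sqfree_ideal U (image ?\<tau> ` image \<sigma> ` S)"
    using q bij_betw_inv_into[OF assms(1)] by (rule rename_poly_sqfree_ideal)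
  moreover have "image ?\<tau> ` image \<sigma> ` S = S"
  proof -
    have "?\<tau> ` \<sigma> ` F = F" if "F \<in> S" for F
      using that assms by (intro inv_into_image_cancel) (auto simp: bij_betw_def)
    then show ?thesis by (simp add: image_image)
  qed
  ultimately show "q \<in> rename_poly \<sigma> ` sqfree_ideal U S" by (metis image_eqI)
qed

lemma indep_image:
  assumes "bij_betw \<sigma> U V" "S \<subseteq> Pow U"
  shows "image \<sigma> ` indep U S = indep V (image \<sigma> ` S)"
proof (intro equalityI subsetI)
  note inj = bij_betw_imp_inj_on[OF assms(1)] and img = bij_betw_imp_surj_on[OF assms(1)]
  fix W assume "W \<in> image \<sigma> ` indep U S"
  then obtain W' where W': "W = \<sigma> ` W'" "W' \<subseteq> U" "\<And>F. F \<in> S \<Longrightarrow> \<not> F \<subseteq> W'" by (auto simp: indep_def)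
  have "\<not> \<sigma> ` F \<subseteq> \<sigma> ` W'" if "F \<in> S" for F
    using W' that assms(2) inj_on_image_subset_iff[OF inj, of F W'] by auto
  then show "W \<in> indep V (image \<sigma> ` S)" using W' img by (auto simp: indep_def)
next
  fix W assume W: "W \<in> indep V (image \<sigma> ` S)"
  define W' where "W' = {x \<in> U. \<sigma> x \<in> W}"
  have "W = \<sigma> ` W'" using W bij_betw_imp_surj_on[OF assms(1)] by (auto simp: W'_def indep_def)
  moreover have "W' \<in> indep U S" using W unfolding indep_def W'_def by blast
  ultimately show "W \<in> image \<sigma> ` indep U S" by blast
qed

lemma antichain_polset:
  assumes "bij_betw \<sigma> (\<Union>(polset ` M)) V" "\<forall>s\<in>M. \<forall>t\<in>M. mdvd s t \<longrightarrow> s = t"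
  shows "antichain_sets (image \<sigma> ` polset ` M)"
  unfolding antichain_sets_def
proof (intro ballI impI)
  fix A B assume "A \<in> image \<sigma> ` polset ` M" "B \<in> image \<sigma> ` polset ` M" and sub: "A \<subseteq> B"
  then obtain s t where st: "s \<in> M" "t \<in> M" "A = \<sigma> ` polset s" "B = \<sigma> ` polset t" by auto
  have "inj_on \<sigma> (\<Union>(polset ` M))" by (rule bij_betw_imp_inj_on[OF assms(1)])
  then have "polset s \<subseteq> polset t"
    using inj_on_image_subset_iff[of \<sigma> _ "polset s" "polset t"] st sub by auto
  then have "s = t" using assms(2) st(1,2) by (simp add: polset_subset_iff)
  then show "A = B" using st by simp
qed

text \<open>Passing to Stanley-Reisner complexes turns the equality of square-free ideals into one
  of independence complexes, and two antichains with the same independence complex agree.\<close>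

lemma is_polarization_of_iff:
  fixes I :: "('v, 'k::field) mpoly set" and J :: "('x, 'k) mpoly set"
  assumes "finite V" "D \<subseteq> Pow V" "I = facet_ideal V D" "minimally_generates X M J"
  shows "is_polarization_of V I X J \<longleftrightarrow>
    (\<exists>\<sigma>. bij_betw \<sigma> (\<Union>(polset ` M)) V \<and> facets D = image \<sigma> ` polset ` M)"
proof -
  let ?U = "\<Union>(polset ` M)"
  have U: "pol_vars X J = ?U" by (simp add: pol_vars_eq min_gens_eq[OF assms(4)])
  have "I = rename_poly \<sigma> ` polarization X J \<longleftrightarrow> facets D = image \<sigma> ` polset ` M"
    if \<sigma>: "bij_betw \<sigma> ?U V" for \<sigma>
  proof -
    have "finite ?U" using bij_betw_finite[OF \<sigma>] assms(1) by simp
    then have "polarization X J = sqfree_ideal ?U (polset ` M)"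
      using polarization_eq[of X J] U by (simp add: min_gens_eq[OF assms(4)])
    moreover have "polset ` M \<subseteq> Pow ?U" by blast
    ultimately have ren: "rename_poly \<sigma> ` polarization X J = sqfree_ideal V (image \<sigma> ` polset ` M)"
      using rename_sqfree_ideal[OF \<sigma>] by simp
    have I: "I = sqfree_ideal V (facets D)" using facet_ideal_eq[OF assms(1,2)] assms(3) by simp
    have "facets D = image \<sigma> ` polset ` M"
      if eq: "sqfree_ideal V (facets D) = (sqfree_ideal V (image \<sigma> ` polset ` M) :: ('v, 'k) mpoly set)"
    proof (rule indep_antichain_eqD[OF antichain_facets antichain_polset])
      show "indep V (facets D) = indep V (image \<sigma> ` polset ` M)"
        using arg_cong[OF eq, of "SR_complex V"] by (simp add: SR_complex_sqfree[OF assms(1)])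
      show "facets D \<subseteq> Pow V" using assms(2) facets_subset by blast
      show "image \<sigma> ` polset ` M \<subseteq> Pow V" using bij_betw_imp_surj_on[OF \<sigma>] by blast
      show "\<forall>s\<in>M. \<forall>t\<in>M. mdvd s t \<longrightarrow> s = t" using assms(4) by (simp add: minimally_generates_iff)
      show "bij_betw \<sigma> ?U V" by (rule \<sigma>)
    qed
    then show ?thesis using ren I by auto
  qed
  then show ?thesis unfolding is_polarization_of_def U by (simp cong: conj_cong)
qed

text \<open>The right-hand side is the one of \<open>is_polarization_of_iff\<close>, so conditions
  (b) and (c) agree for each single ideal \<open>J\<close>, with the same relabelling.\<close>

lemma complex_iso_polarization_iff:
  fixes J :: "('x, 'k::field) mpoly set"
  assumes "finite V" "D \<subseteq> Pow V" "minimally_generates X M J"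
  shows "complex_iso (pol_vars X J) (SR_complex (pol_vars X J) (polarization X J)) V (Ind V D) \<longleftrightarrow>
    (\<exists>\<sigma>. bij_betw \<sigma> (\<Union>(polset ` M)) V \<and> facets D = image \<sigma> ` polset ` M)"
proof -
  let ?U = "\<Union>(polset ` M)"
  have U: "pol_vars X J = ?U" by (simp add: pol_vars_eq min_gens_eq[OF assms(3)])
  have "Ind V D = image \<sigma> ` SR_complex (pol_vars X J) (polarization X J) \<longleftrightarrow>
      facets D = image \<sigma> ` polset ` M"
    if \<sigma>: "bij_betw \<sigma> ?U V" for \<sigma>
  proof -
    have fin: "finite ?U" using bij_betw_finite[OF \<sigma>] assms(1) by simp
    then have "polarization X J = sqfree_ideal ?U (polset ` M)"
      using polarization_eq[of X J] U by (simp add: min_gens_eq[OF assms(3)])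
    moreover have "polset ` M \<subseteq> Pow ?U" by blast
    ultimately have im: "image \<sigma> ` SR_complex (pol_vars X J) (polarization X J) = indep V (image \<sigma> ` polset ` M)"
      using indep_image[OF \<sigma>] U SR_complex_sqfree[OF fin, where ?'k = 'k] by simp
    have "facets D = image \<sigma> ` polset ` M"
      if eq: "indep V (facets D) = indep V (image \<sigma> ` polset ` M)"
    proof (rule indep_antichain_eqD[OF antichain_facets antichain_polset _ _ eq])
      show "facets D \<subseteq> Pow V" using assms(2) facets_subset by blast
      show "image \<sigma> ` polset ` M \<subseteq> Pow V" using bij_betw_imp_surj_on[OF \<sigma>] by blast
      show "\<forall>s\<in>M. \<forall>t\<in>M. mdvd s t \<longrightarrow> s = t" using assms(3) by (simp add: minimally_generates_iff)
      show "bij_betw \<sigma> ?U V" by (rule \<sigma>)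
    qed
    then show ?thesis using im by (auto simp: Ind_eq_indep)
  qed
  then show ?thesis unfolding complex_iso_def U by (simp cong: conj_cong)
qed

lemma pvar_power: "pvar x ^ b = (mon (Poly_Mapping.single x b) :: ('x, 'k::field) mpoly)"
proof (induction b)
  case (Suc b)
  have "Poly_Mapping.single x (Suc b) = Poly_Mapping.single x 1 + Poly_Mapping.single x b"
    by (simp flip: single_add)
  then show ?case using Suc by (simp add: pvar_def mon_def mult_single)
qed (simp add: mon_def)

text \<open>A generator that divides a power of one variable is itself a power of that
  variable.\<close>

lemma artinian_iff:
  fixes J :: "('x, 'k::field) mpoly set"
  assumes "minimally_generates X M J"
  shows "artinian_monomial_ideal X J \<longleftrightarrow> (\<forall>i\<in>X. \<exists>a. Poly_Mapping.single i a \<in> M)"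
proof -
  have M: "M \<subseteq> mons_on X" and J: "J = {p. keys p \<subseteq> upset X M}"
    using assms by (auto simp: minimally_generates_iff)
  have "monomial_ideal X J"
    unfolding monomial_ideal_def using M J Idl_mon[OF M, where ?'k = 'k] by auto
  moreover have "(\<exists>b. pvar i ^ b \<in> J) \<longleftrightarrow> (\<exists>a. Poly_Mapping.single i a \<in> M)" if i: "i \<in> X" for i
  proof
    assume "\<exists>b. pvar i ^ b \<in> J"
    then obtain b where "Poly_Mapping.single i b \<in> upset X M" by (auto simp: J pvar_power keys_mon)
    then obtain m where m: "m \<in> M" "mdvd m (Poly_Mapping.single i b)" by (auto simp: upset_def)
    have "m = Poly_Mapping.single i (lookup m i)"
    proof (rule poly_mapping_eqI)
      fix x show "lookup m x = lookup (Poly_Mapping.single i (lookup m i)) x"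
        using m(2) by (cases "x = i") (auto simp: mdvd_def lookup_single when_def split: if_splits)
    qed
    then show "\<exists>a. Poly_Mapping.single i a \<in> M" using m(1) by metis
  next
    assume "\<exists>a. Poly_Mapping.single i a \<in> M"
    then show "\<exists>b. pvar i ^ b \<in> J" using upset_self[OF M] by (auto simp: J pvar_power keys_mon)
  qed
  ultimately show ?thesis by (simp add: artinian_monomial_ideal_def)
qed

lemma polset_single: "polset (Poly_Mapping.single i a) = {i} \<times> {1..a}"
  by (auto simp: polset_def lookup_single when_def split: if_splits)

text \<open>The cells are the polarized pure powers. By the antichain condition no generator has
  exponent above \<open>a i\<close> at \<open>i\<close>, so these cells cover all variables; the
  trace of a generator on a cell is an initial segment of it, and initial segments are
  nested.\<close>

lemma polarization_grafting:
  fixes X :: "'x set" and a :: "'x \<Rightarrow> nat"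
  assumes "finite X" "V \<noteq> {}" and \<sigma>: "bij_betw \<sigma> (\<Union>(polset ` M)) V" and M: "M \<subseteq> mons_on X"
    and anti: "\<forall>s\<in>M. \<forall>t\<in>M. mdvd s t \<longrightarrow> s = t" and a: "\<And>i. i \<in> X \<Longrightarrow> Poly_Mapping.single i (a i) \<in> M"
  defines "F \<equiv> \<lambda>i. \<sigma> ` polset (Poly_Mapping.single i (a i))"
  shows "grafting (F ` X) (image \<sigma> ` polset ` M)" "\<Union>(F ` X) = V" "{} \<notin> image \<sigma> ` polset ` M"
    "inj_on F X" "card V = (\<Sum>i\<in>X. a i)"
proof -
  let ?U = "\<Union>(polset ` M)"
  have inj: "inj_on \<sigma> ?U" and img: "\<sigma> ` ?U = V" using \<sigma> by (auto simp: bij_betw_def)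
  \<comment> \<open>The monomial 1 divides everything, so as a generator it would be the only one;
    polarization would then have no variables, against \<open>V\<close> being nonempty.\<close>
  have zero: "0 \<notin> M"
  proof
    assume "0 \<in> M"
    then have "t = 0" if "t \<in> M" for t using anti that by (auto simp: mdvd_def)
    then have "polset t = {}" if "t \<in> M" for t using that by (fastforce simp: polset_def)
    then have "?U = {}" by simp
    then show False using img assms(2) by simp
  qed
  have le: "lookup t i \<le> a i" if "t \<in> M" "i \<in> X" for t i
  proof (rule ccontr)
    assume "\<not> lookup t i \<le> a i"
    then have "mdvd (Poly_Mapping.single i (a i)) t" by (auto simp: mdvd_def lookup_single when_def)
    then have "Poly_Mapping.single i (a i) = t" using anti a that by blast
    then show False using \<open>\<not> lookup t i \<le> a i\<close> by auto
  qed
  have polset_sub: "polset t \<subseteq> (SIGMA i:X. {1..a i})" if "t \<in> M" for t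
  proof -
    have "keys t \<subseteq> X" using that M by (auto simp: mons_on_def)
    then show ?thesis unfolding polset_Sigma using le[OF that] by (intro Sigma_mono) auto
  qed
  have U: "?U = (SIGMA i:X. {1..a i})"
  proof
    show "?U \<subseteq> (SIGMA i:X. {1..a i})" using polset_sub by blast
    show "(SIGMA i:X. {1..a i}) \<subseteq> ?U"
    proof clarify
      fix i j assume "i \<in> X" "j \<in> {1..a i}"
      then show "(i, j) \<in> ?U" using a[of i] by (auto simp: polset_single intro!: bexI[of _ "Poly_Mapping.single i (a i)"])
    qed
  qed
  have apos: "1 \<le> a i" if "i \<in> X" for i
    using a[OF that] zero by (cases "a i") auto
  have F: "F i = \<sigma> ` ({i} \<times> {1..a i})" for i by (simp add: F_def polset_single)
  show cover: "\<Union>(F ` X) = V" unfolding img[symmetric] U F by auto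
  show "{} \<notin> image \<sigma> ` polset ` M"
  proof
    assume "{} \<in> image \<sigma> ` polset ` M"
    then obtain t where t: "t \<in> M" "polset t = {}" by auto
    then have "t = 0" by (intro poly_mapping_eqI) (auto simp: polset_def Suc_le_eq)
    then show False using zero t by simp
  qed
  have disj: "F i \<inter> F j = {}" if "i \<in> X" "j \<in> X" "i \<noteq> j" for i j
  proof -
    have "F i \<inter> F j = \<sigma> ` ({i} \<times> {1..a i} \<inter> {j} \<times> {1..a j})"
      unfolding F using that U by (intro inj_on_image_Int[OF inj, symmetric]) auto
    then show ?thesis using that by auto
  qed
  have Fne: "F i \<noteq> {}" if "i \<in> X" for i using apos[OF that] by (auto simp: F)
  show "inj_on F X" using disj Fne by (intro inj_onI) (metis Int_absorb)
  have "card V = card ?U" using bij_betw_same_card[OF \<sigma>] by simp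
  also have "\<dots> = (\<Sum>i\<in>X. a i)" unfolding U using assms(1) by simp
  finally show "card V = (\<Sum>i\<in>X. a i)" .
  have trace: "\<sigma> ` polset t \<inter> F i = \<sigma> ` ({i} \<times> {1..lookup t i})" if "t \<in> M" "i \<in> X" for t i
  proof -
    have "\<sigma> ` polset t \<inter> F i = \<sigma> ` (polset t \<inter> {i} \<times> {1..a i})"
      unfolding F using that U by (intro inj_on_image_Int[OF inj, symmetric]) auto
    also have "polset t \<inter> {i} \<times> {1..a i} = {i} \<times> {1..lookup t i}"
      using le[OF that] by (auto simp: polset_def)
    finally show ?thesis .
  qed
  show "grafting (F ` X) (image \<sigma> ` polset ` M)"
    unfolding grafting_def
  proof (intro conjI)
    show "F ` X \<subseteq> image \<sigma> ` polset ` M" using a by (auto simp: F_def)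
    show "\<Union>(image \<sigma> ` polset ` M) \<subseteq> \<Union>(F ` X)" unfolding cover using img by auto
    show "\<forall>A\<in>F ` X. \<forall>B\<in>F ` X. A \<noteq> B \<longrightarrow> A \<inter> B = {}" using disj by auto
    show "\<forall>A\<in>F ` X. \<forall>G\<in>image \<sigma> ` polset ` M. \<forall>H\<in>image \<sigma> ` polset ` M. G \<inter> A \<subseteq> H \<inter> A \<or> H \<inter> A \<subseteq> G \<inter> A"
    proof (intro ballI)
      fix A G H assume "A \<in> F ` X" "G \<in> image \<sigma> ` polset ` M" "H \<in> image \<sigma> ` polset ` M"
      then obtain i s t where "i \<in> X" "s \<in> M" "t \<in> M" "A = F i" "G = \<sigma> ` polset s" "H = \<sigma> ` polset t"
        by auto
      then show "G \<inter> A \<subseteq> H \<inter> A \<or> H \<inter> A \<subseteq> G \<inter> A"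
        using trace by (cases "lookup s i \<le> lookup t i") (auto intro!: image_mono)
    qed
  qed
qed

text \<open>A point outside the largest proper member of the chain lies in no member except possibly
  \<open>F\<close> itself. It is put last, and the rest is enumerated by induction.\<close>

lemma chain_enumeration:
  assumes "finite F" "C \<subseteq> Pow F" "\<And>A B. A \<in> C \<Longrightarrow> B \<in> C \<Longrightarrow> A \<subseteq> B \<or> B \<subseteq> A"
  shows "\<exists>e. bij_betw e {1..card F} F \<and> (\<forall>A\<in>C. e ` {1..card A} = A)"
  using assms
proof (induction "card F" arbitrary: F C)
  case 0
  then have "F = {}" by simp
  then have "A = {}" if "A \<in> C" for A using 0 that by blast
  then have "e ` {1..card A} = A" if "A \<in> C" for A and e :: "nat \<Rightarrow> 'a" using that by fastforce
  then show ?case using \<open>F = {}\<close> by (simp add: bij_betw_def)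
next
  case (Suc n)
  have "\<exists>x\<in>F. \<forall>A\<in>C. x \<in> A \<longrightarrow> A = F"
  proof (cases "C - {F} = {}")
    case True
    have "F \<noteq> {}" using Suc.hyps(2) by auto
    then show ?thesis using True by blast
  next
    case False
    have "finite (C - {F})" using Suc.prems(1,2) by (meson finite_Diff finite_Pow_iff finite_subset)
    then obtain T where T: "T \<in> C - {F}" "\<And>A. A \<in> C - {F} \<Longrightarrow> T \<subseteq> A \<Longrightarrow> T = A"
      using finite_has_maximal[OF _ False] by metis
    then obtain x where x: "x \<in> F" "x \<notin> T" using Suc.prems(2) by blast
    have "A = F" if "A \<in> C" "x \<in> A" for A
      using Suc.prems(3)[of A T] T(1) T(2)[of A] that x by blast
    then show ?thesis using x by blast
  qed
  then obtain x where x: "x \<in> F" "\<And>A. A \<in> C \<Longrightarrow> x \<in> A \<Longrightarrow> A = F" by blast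
  have cF: "card (F - {x}) = n" using Suc.hyps(2) x(1) Suc.prems(1) by simp
  have "\<exists>e. bij_betw e {1..card (F - {x})} (F - {x}) \<and> (\<forall>A\<in>C - {F}. e ` {1..card A} = A)"
    by (rule Suc.hyps(1)) (use cF Suc.prems x in auto)
  then obtain e where e: "bij_betw e {1..n} (F - {x})" "\<And>A. A \<in> C - {F} \<Longrightarrow> e ` {1..card A} = A"
    using cF by auto
  define e' where "e' = e(Suc n := x)"
  have "bij_betw e' {1..n} (F - {x})"
    using e(1) by (rule bij_betw_cong[THEN iffD1, rotated]) (auto simp: e'_def)
  then have "bij_betw e' ({1..n} \<union> {Suc n}) ((F - {x}) \<union> {e' (Suc n)})"
    using notIn_Un_bij_betw3[of "Suc n" "{1..n}" e' "F - {x}"] by (simp add: e'_def)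
  moreover have "{1..n} \<union> {Suc n} = {1..card F}" using Suc.hyps(2) by auto
  moreover have "(F - {x}) \<union> {e' (Suc n)} = F" using x by (auto simp: e'_def)
  ultimately have bij: "bij_betw e' {1..card F} F" by simp
  moreover have "e' ` {1..card A} = A" if A: "A \<in> C" for A
  proof (cases "A = F")
    case True
    then show ?thesis using bij by (simp add: bij_betw_def)
  next
    case False
    then have "A \<subseteq> F - {x}" using A x Suc.prems(2) by blast
    then have "card A \<le> n" using cF Suc.prems(1) by (metis card_mono finite_Diff)
    then have "e' ` {1..card A} = e ` {1..card A}" by (intro image_cong) (auto simp: e'_def)
    then show ?thesis using e(2) A False by simp
  qed
  ultimately show ?case by blast
qed

text \<open>The exponent of variable \<open>i\<close> in the monomial of \<open>G\<close> is the
  size of the trace of \<open>G\<close> on the cell \<open>f i\<close>. Enumerating each cell along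
  its chain of traces makes \<open>\<sigma>\<close> carry the polarized monomial back to
  \<open>G\<close>. A cell has empty trace on all other cells, so it gives a pure power.\<close>

lemma grafting_polarization:
  assumes "finite V" "antichain_sets S" "grafting Fs S" "\<Union>Fs = V" "S \<subseteq> Pow V"
  obtains m :: nat and M \<sigma> where "M \<subseteq> mons_on {1..m}" "\<forall>s\<in>M. \<forall>t\<in>M. mdvd s t \<longrightarrow> s = t"
    "\<forall>i\<in>{1..m}. \<exists>a. Poly_Mapping.single i a \<in> M" "bij_betw \<sigma> (\<Union>(polset ` M)) V"
    "S = image \<sigma> ` polset ` M"
proof -
  note gr = graftingD[OF assms(3)]
  have "finite S" using assms(1,5) by (meson finite_Pow_iff finite_subset)
  then have "finite Fs" using gr(1) finite_subset by blast
  then obtain f where f: "bij_betw f {1..card Fs} Fs" using ex_bij_betw_nat_finite_1 by blast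
  define m where "m = card Fs"
  have fFs: "f i \<in> Fs" if "i \<in> {1..m}" for i using f that by (auto simp: m_def bij_betw_def)
  have fdisj: "f i \<inter> f j = {}" if "i \<in> {1..m}" "j \<in> {1..m}" "i \<noteq> j" for i j
    using gr(3) fFs that f by (metis bij_betw_inv_into_left m_def)
  have ffin: "finite (f i)" if "i \<in> {1..m}" for i
    using fFs[OF that] assms(1,4) by (metis Union_upper finite_subset)
  have "\<exists>e. bij_betw e {1..card (f i)} (f i) \<and> (\<forall>A\<in>(\<lambda>G. G \<inter> f i) ` S. e ` {1..card A} = A)"
    if i: "i \<in> {1..m}" for i
    by (rule chain_enumeration) (use ffin[OF i] gr(4)[OF fFs[OF i]] in auto)
  then obtain e where e: "\<And>i. i \<in> {1..m} \<Longrightarrow> bij_betw (e i) {1..card (f i)} (f i)"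
    "\<And>i G. i \<in> {1..m} \<Longrightarrow> G \<in> S \<Longrightarrow> e i ` {1..card (G \<inter> f i)} = G \<inter> f i"
    by (metis imageI)
  define \<sigma> where "\<sigma> = (\<lambda>(i, j). e i j)"
  define ex where "ex G = (\<Sum>i\<in>{1..m}. Poly_Mapping.single i (card (G \<inter> f i)))" for G
  have lookup_ex: "lookup (ex G) i = (if i \<in> {1..m} then card (G \<inter> f i) else 0)" for G i
    by (auto simp: ex_def lookup_sum lookup_single when_def)
  define M where "M = ex ` S"
  have polset_ex: "polset (ex G) = (SIGMA i:{1..m}. {1..card (G \<inter> f i)})" for G
    by (auto simp: polset_def lookup_ex split: if_splits)
  have coverf: "\<Union>(f ` {1..m}) = V" using f assms(4) by (simp add: m_def bij_betw_def)
  have img: "\<sigma> ` polset (ex G) = G" if G: "G \<in> S" for G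
  proof -
    have "\<sigma> ` polset (ex G) = (\<Union>i\<in>{1..m}. e i ` {1..card (G \<inter> f i)})"
      unfolding polset_ex \<sigma>_def by force
    also have "\<dots> = (\<Union>i\<in>{1..m}. G \<inter> f i)" using e(2) G by simp
    also have "\<dots> = G" using coverf G assms(5) by blast
    finally show ?thesis .
  qed
  have U: "\<Union>(polset ` M) = (SIGMA i:{1..m}. {1..card (f i)})"
  proof
    have "card (G \<inter> f i) \<le> card (f i)" if "i \<in> {1..m}" for G i
      using ffin[OF that] by (simp add: card_mono)
    then have "polset (ex G) \<subseteq> (SIGMA i:{1..m}. {1..card (f i)})" for G
      unfolding polset_ex by (intro Sigma_mono) auto
    then show "\<Union>(polset ` M) \<subseteq> (SIGMA i:{1..m}. {1..card (f i)})"
      unfolding M_def by blast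
    show "(SIGMA i:{1..m}. {1..card (f i)}) \<subseteq> \<Union>(polset ` M)"
    proof clarify
      fix i j assume ij: "i \<in> {1..m}" "j \<in> {1..card (f i)}"
      then have "(i, j) \<in> polset (ex (f i))" by (simp add: polset_ex)
      then show "(i, j) \<in> \<Union>(polset ` M)" using fFs[OF ij(1)] gr(1) by (auto simp: M_def)
    qed
  qed
  have bij: "bij_betw \<sigma> (\<Union>(polset ` M)) V"
    unfolding bij_betw_def
  proof
    show "inj_on \<sigma> (\<Union>(polset ` M))" unfolding U
    proof (rule inj_onI, clarify)
      fix i j i' j' assume ij: "i \<in> {1..m}" "j \<in> {1..card (f i)}" "i' \<in> {1..m}" "j' \<in> {1..card (f i')}"
        and eq: "\<sigma> (i, j) = \<sigma> (i', j')"
      have "e i j \<in> f i" "e i' j' \<in> f i'"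
        using bij_betwE[OF e(1)] ij by blast+
      then have "i = i'" using fdisj[of i i'] ij eq by (auto simp: \<sigma>_def)
      moreover from this have "j = j'"
        using inj_onD[OF bij_betw_imp_inj_on[OF e(1)[OF ij(1)]], of j j'] ij eq by (simp add: \<sigma>_def)
      ultimately show "i = i' \<and> j = j'" by simp
    qed
    have "\<sigma> ` (SIGMA i:{1..m}. {1..card (f i)}) = (\<Union>i\<in>{1..m}. e i ` {1..card (f i)})"
      unfolding \<sigma>_def by force
    also have "\<dots> = V" using e(1) coverf by (simp add: bij_betw_def)
    finally show "\<sigma> ` \<Union>(polset ` M) = V" by (simp only: U)
  qed
  show ?thesis
  proof (rule that[OF _ _ _ bij])
    show "M \<subseteq> mons_on {1..m}" by (auto simp: M_def mons_on_def in_keys_iff lookup_ex split: if_splits)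
    show "\<forall>s\<in>M. \<forall>t\<in>M. mdvd s t \<longrightarrow> s = t"
    proof (intro ballI impI)
      fix s t assume "s \<in> M" "t \<in> M" and dv: "mdvd s t"
      then obtain G H where GH: "G \<in> S" "H \<in> S" "s = ex G" "t = ex H" by (auto simp: M_def)
      have "\<sigma> ` polset s \<subseteq> \<sigma> ` polset t" using dv by (intro image_mono) (simp add: polset_subset_iff)
      then have "G \<subseteq> H" using GH img by simp
      then show "s = t" using GH assms(2) by (auto simp: antichain_sets_def)
    qed
    show "\<forall>i\<in>{1..m}. \<exists>a. Poly_Mapping.single i a \<in> M"
    proof
      fix i assume i: "i \<in> {1..m}"
      have "ex (f i) = Poly_Mapping.single i (card (f i))"
        using fdisj[OF i] i by (intro poly_mapping_eqI) (auto simp: lookup_ex lookup_single when_def)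
      moreover have "ex (f i) \<in> M" using fFs[OF i] gr(1) by (auto simp: M_def)
      ultimately show "\<exists>a. Poly_Mapping.single i a \<in> M" by metis
    qed
    show "S = image \<sigma> ` polset ` M" using img by (simp add: M_def image_image)
  qed
qed

section \<open>Spheres and hemispheres\<close>

lemma continuous_map_Min:
  assumes "finite A" "A \<noteq> {}" "\<And>a. a \<in> A \<Longrightarrow> continuous_map X euclideanreal (f a)"
  shows "continuous_map X euclideanreal (\<lambda>x. Min ((\<lambda>a. f a x) ` A))"
  using assms
proof (induction A rule: finite_ne_induct)
  case (insert a A)
  then have "continuous_map X euclideanreal (\<lambda>x. min (f a x) (Min ((\<lambda>a. f a x) ` A)))"
    by (intro continuous_map_real_min) auto
  then show ?case using insert.hyps by simp
qed simp

lemma continuous_map_Max: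
  assumes "finite A" "A \<noteq> {}" "\<And>a. a \<in> A \<Longrightarrow> continuous_map X euclideanreal (f a)"
  shows "continuous_map X euclideanreal (\<lambda>x. Max ((\<lambda>a. f a x) ` A))"
  using assms
proof (induction A rule: finite_ne_induct)
  case (insert a A)
  then have "continuous_map X euclideanreal (\<lambda>x. max (f a x) (Max ((\<lambda>a. f a x) ` A)))"
    by (intro continuous_map_real_max) auto
  then show ?case using insert.hyps by simp
qed simp

lemma topspace_nsphere: "topspace (nsphere n) = {x. (\<Sum>i\<le>n. (x i)\<^sup>2) = 1 \<and> (\<forall>i>n. x i = 0)}"
  by (auto simp: nsphere)

lemma Hausdorff_powertop_real: "Hausdorff_space (powertop_real UNIV)"
  by (simp add: Hausdorff_space_product_topology)

text \<open>The sphere is closed in a compact product of intervals and points. Compactness reduces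
  the homeomorphisms constructed below to continuous bijections onto Hausdorff spaces.\<close>

lemma compact_space_nsphere: "compact_space (nsphere n)"
proof -
  let ?S = "topspace (nsphere n)"
  let ?C = "\<Pi>\<^sub>E i\<in>UNIV. (if i \<le> n then {-1..1} else {0::real})"
  have cont: "continuous_map (powertop_real UNIV) euclideanreal (\<lambda>x. x i)" for i :: nat
    by (rule continuous_map_product_projection) simp
  have "continuous_map (powertop_real UNIV) euclideanreal (\<lambda>x. \<Sum>i\<le>n. (x i)\<^sup>2)"
    by (intro continuous_map_sum continuous_map_real_pow cont) simp
  then have c1: "closedin (powertop_real UNIV) {x \<in> topspace (powertop_real UNIV). (\<Sum>i\<le>n. (x i)\<^sup>2) \<in> {1}}"
    by (rule closedin_continuous_map_preimage) simp
  have c2: "closedin (powertop_real UNIV) {x \<in> topspace (powertop_real UNIV). x i \<in> {0}}" for i :: nat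
    by (rule closedin_continuous_map_preimage[OF cont]) simp
  have "closedin (powertop_real UNIV) (\<Inter>i\<in>{n<..}. {x \<in> topspace (powertop_real UNIV). x i \<in> {0::real}})"
    by (rule closedin_INT) (use c2 in auto)
  then have "closedin (powertop_real UNIV) ({x \<in> topspace (powertop_real UNIV). (\<Sum>i\<le>n. (x i)\<^sup>2) \<in> {1::real}} \<inter>
      (\<Inter>i\<in>{n<..}. {x \<in> topspace (powertop_real UNIV). x i \<in> {0}}))"
    using c1 by (rule closedin_Int[rotated])
  moreover have "{x \<in> topspace (powertop_real UNIV). (\<Sum>i\<le>n. (x i)\<^sup>2) \<in> {1::real}} \<inter>
      (\<Inter>i\<in>{n<..}. {x \<in> topspace (powertop_real UNIV). x i \<in> {0}}) = ?S"
    by (auto simp: topspace_nsphere)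
  ultimately have "closedin (powertop_real UNIV) ?S" by simp
  moreover have "?S \<subseteq> ?C"
  proof
    fix x assume x: "x \<in> ?S"
    have "x i \<in> {-1..1}" if "i \<le> n" for i
    proof -
      have "(x i)\<^sup>2 \<le> (\<Sum>i\<le>n. (x i)\<^sup>2)"
        by (rule member_le_sum) (use that in auto)
      then have "\<bar>x i\<bar> \<le> 1" using x by (simp add: topspace_nsphere abs_square_le_1)
      then show ?thesis by auto
    qed
    then show "x \<in> ?C" using x by (auto simp: topspace_nsphere)
  qed
  moreover have "compactin (powertop_real UNIV) ?C"
    by (simp add: compactin_PiE)
  ultimately have "compactin (powertop_real UNIV) ?S"
    by (meson closed_compactin)
  then show ?thesis
    unfolding nsphere by (intro compact_space_subtopology) (simp add: topspace_nsphere)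
qed

lemma compact_space_subtopology_nsphere:
  assumes "closedin (nsphere n) {x \<in> topspace (nsphere n). Q x}"
  shows "compact_space (subtopology (nsphere n) {x. Q x})"
proof -
  have "topspace (nsphere n) \<inter> {x. Q x} = {x \<in> topspace (nsphere n). Q x}" by auto
  then have "subtopology (nsphere n) {x. Q x} = subtopology (nsphere n) {x \<in> topspace (nsphere n). Q x}"
    using subtopology_restrict[of "nsphere n" "{x. Q x}"] by simp
  then show ?thesis
    using closedin_compact_space[OF compact_space_nsphere assms] compact_space_subtopology by simp
qed

lemma closedin_lower_hemisphere: "closedin (nsphere n) {x \<in> topspace (nsphere n). x k \<le> 0}"
  using closedin_continuous_map_preimage[OF continuous_map_nsphere_projection, of "{..0}" n k] by simp

text \<open>Vertical projection: the last coordinate is dropped, and it is recovered as the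
  nonpositive square root.\<close>

lemma hemisphere_homeomorphic_ball:
  "subtopology (nsphere n) {x. x n \<le> 0} homeomorphic_space closed_ball_space n"
proof -
  let ?X = "subtopology (nsphere n) {x. x n \<le> 0}"
  define p :: "(nat \<Rightarrow> real) \<Rightarrow> nat \<Rightarrow> real" where "p x = (\<lambda>i. if i < n then x i else 0)" for x
  have topX: "topspace ?X = {x. (\<Sum>i\<le>n. (x i)\<^sup>2) = 1 \<and> (\<forall>i>n. x i = 0) \<and> x n \<le> 0}"
    by (auto simp: topspace_nsphere)
  have ball: "closed_ball_space n = subtopology (powertop_real UNIV) {x. (\<forall>i\<ge>n. x i = 0) \<and> (\<Sum>i<n. (x i)\<^sup>2) \<le> 1}"
    by (simp add: closed_ball_space_def Euclidean_space_def subtopology_subtopology Collect_conj_eq)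
  have split: "(\<Sum>i\<le>n. (x i)\<^sup>2) = (\<Sum>i<n. (x i)\<^sup>2) + (x n)\<^sup>2" for x :: "nat \<Rightarrow> real"
    by (simp flip: lessThan_Suc_atMost)
  have psum: "(\<Sum>i<n. (p x i)\<^sup>2) = (\<Sum>i<n. (x i)\<^sup>2)" for x by (simp add: p_def)
  have "homeomorphic_map ?X (closed_ball_space n) p"
  proof (rule continuous_imp_homeomorphic_map)
    have "continuous_map ?X euclideanreal (\<lambda>x. p x i)" for i
      unfolding p_def using continuous_map_from_subtopology[OF continuous_map_nsphere_projection]
      by (cases "i < n") auto
    moreover have "(\<Sum>i<n. (p x i)\<^sup>2) \<le> 1" if "x \<in> topspace ?X" for x
      using that zero_le_power2[of "x n"] unfolding topX psum split mem_Collect_eq by linarith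
    ultimately show "continuous_map ?X (closed_ball_space n) p"
      unfolding ball continuous_map_in_subtopology continuous_map_componentwise_UNIV
      by (auto simp: p_def)
    show "compact_space ?X"
      using closedin_lower_hemisphere by (rule compact_space_subtopology_nsphere)
    show "Hausdorff_space (closed_ball_space n)"
      unfolding ball by (intro Hausdorff_space_subtopology Hausdorff_powertop_real)
    show "inj_on p (topspace ?X)"
    proof (rule inj_onI)
      fix x y assume x: "x \<in> topspace ?X" and y: "y \<in> topspace ?X" and eq: "p x = p y"
      have "(x n)\<^sup>2 = (y n)\<^sup>2" using x y psum[of x] psum[of y] eq unfolding topX split by auto
      then have "x n = y n" using x y unfolding topX by (auto simp: power2_eq_iff)
      moreover have "x i = y i" if "i < n" for i using fun_cong[OF eq, of i] that by (simp add: p_def)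
      ultimately have "x i = y i" for i using x y unfolding topX by (cases i n rule: linorder_cases) auto
      then show "x = y" by blast
    qed
    show "p ` topspace ?X = topspace (closed_ball_space n)"
    proof (intro equalityI subsetI)
      fix y assume "y \<in> p ` topspace ?X"
      then obtain x where x: "x \<in> topspace ?X" "y = p x" by blast
      have "(\<Sum>i<n. (p x i)\<^sup>2) \<le> 1"
        using x(1) zero_le_power2[of "x n"] unfolding topX psum split mem_Collect_eq by linarith
      then show "y \<in> topspace (closed_ball_space n)" using x(2) by (simp add: ball p_def)
    next
      fix y assume "y \<in> topspace (closed_ball_space n)"
      then have y: "\<forall>i\<ge>n. y i = 0" "(\<Sum>i<n. (y i)\<^sup>2) \<le> 1" by (auto simp: ball)
      define x where "x = y(n := - sqrt (1 - (\<Sum>i<n. (y i)\<^sup>2)))"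
      have "(\<Sum>i<n. (x i)\<^sup>2) = (\<Sum>i<n. (y i)\<^sup>2)" by (simp add: x_def)
      moreover have "(x n)\<^sup>2 = 1 - (\<Sum>i<n. (y i)\<^sup>2)" using y(2) by (simp add: x_def)
      ultimately have "x \<in> topspace ?X" using y unfolding topX split by (auto simp: x_def)
      moreover have "p x = y" using y(1) by (auto simp: p_def x_def fun_eq_iff)
      ultimately show "y \<in> p ` topspace ?X" by blast
    qed
  qed
  then show ?thesis by (rule homeomorphic_map_imp_homeomorphic_space)
qed

section \<open>Joins of boundaries of simplices\<close>

text \<open>The join of the boundaries of the simplices on the cells \<open>F \<in> Fs\<close> is the boundary of a
  simplicial polytope in the space of functions on \<open>V\<close> modulo functions constant on cells. That
  space is represented by the functions vanishing on the chosen points \<open>r F\<close>; subtracting the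
  minimum over each cell recovers barycentric coordinates up to scaling.\<close>

locale cells =
  fixes V :: "'v set" and Fs :: "'v set set" and r :: "'v set \<Rightarrow> 'v"
  assumes finite_V: "finite V" and cover: "\<Union>Fs = V"
    and disjoint: "\<And>F F'. F \<in> Fs \<Longrightarrow> F' \<in> Fs \<Longrightarrow> F \<noteq> F' \<Longrightarrow> F \<inter> F' = {}"
    and r_in: "\<And>F. F \<in> Fs \<Longrightarrow> r F \<in> F"
begin

definition cell :: "'v \<Rightarrow> 'v set" where
  "cell x = (THE F. F \<in> Fs \<and> x \<in> F)"

definition root :: "'v \<Rightarrow> 'v" where
  "root x = r (cell x)"

definition free :: "'v set" where
  "free = V - r ` Fs"

definition normal :: "('v \<Rightarrow> real) set" where
  "normal = {z. \<forall>x. x \<notin> free \<longrightarrow> z x = 0}"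

definition height :: "('v \<Rightarrow> real) \<Rightarrow> 'v \<Rightarrow> real" where
  "height z x = (if x \<in> V then z x - Min (z ` cell x) else 0)"

lemma cell_eq: "F \<in> Fs \<Longrightarrow> x \<in> F \<Longrightarrow> cell x = F"
  unfolding cell_def using disjoint by (intro the_equality) blast+

lemma cell: assumes "x \<in> V" shows "cell x \<in> Fs" "x \<in> cell x"
proof -
  obtain F where "F \<in> Fs" "x \<in> F" using assms cover by blast
  then show "cell x \<in> Fs" "x \<in> cell x" using cell_eq by auto
qed

lemma finite_cell: "x \<in> V \<Longrightarrow> finite (cell x)"
  using cell(1) finite_V cover by (metis Union_upper finite_subset)

lemma cell_subset: "x \<in> V \<Longrightarrow> cell x \<subseteq> V"
  using cell(1) cover by blast

lemma cell_cell: "x \<in> V \<Longrightarrow> y \<in> cell x \<Longrightarrow> cell y = cell x"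
  using cell(1) cell_eq by blast

lemma root_root: assumes "F \<in> Fs" shows "root (r F) = r F"
  using cell_eq[OF assms r_in[OF assms]] by (simp add: root_def)

lemma root_in: "x \<in> V \<Longrightarrow> root x \<in> cell x"
  using cell(1) r_in by (simp add: root_def)

lemma root_V: "x \<in> V \<Longrightarrow> root x \<in> V"
  using root_in cell_subset by blast

lemma root_image: "x \<in> V \<Longrightarrow> root x \<in> r ` Fs"
  using cell(1) by (simp add: root_def)

lemma normal_root: "z \<in> normal \<Longrightarrow> x \<in> V \<Longrightarrow> z (root x) = 0"
  using root_image by (auto simp: normal_def free_def)

lemma height_nonneg: "0 \<le> height z x"
proof (cases "x \<in> V")
  case True
  then have "Min (z ` cell x) \<le> z x" using cell(2) finite_cell by simp
  then show ?thesis by (simp add: height_def)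
qed (simp add: height_def)

lemma height_eq_0_iff:
  assumes "x \<in> V"
  shows "height z x = 0 \<longleftrightarrow> (\<forall>y\<in>cell x. z x \<le> z y)"
proof -
  have fin: "finite (z ` cell x)" "z ` cell x \<noteq> {}" using finite_cell cell(2) assms by auto
  have "height z x = 0 \<longleftrightarrow> z x \<le> Min (z ` cell x)"
    using Min_le[OF fin(1), of "z x"] cell(2)[OF assms] assms by (auto simp: height_def)
  also have "\<dots> \<longleftrightarrow> (\<forall>y\<in>cell x. z x \<le> z y)" using fin by simp
  finally show ?thesis .
qed

text \<open>On each cell \<open>z\<close> and \<open>height z\<close> differ by a constant, and
  \<open>z\<close> vanishes at the root, which fixes this constant. So \<open>height\<close> is
  injective on \<open>normal\<close>.\<close>

lemma height_diff:
  assumes "z \<in> normal"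
  shows "z x = (if x \<in> V then height z x - height z (root x) else 0)"
proof (cases "x \<in> V")
  case True
  have "cell (root x) = cell x" using cell_cell[OF True root_in[OF True]] .
  then show ?thesis using True root_V[OF True] normal_root[OF assms True] by (simp add: height_def)
next
  case False
  then show ?thesis using assms by (simp add: normal_def free_def)
qed

lemma height_zero_in_cell:
  assumes "F \<in> Fs"
  shows "\<exists>x\<in>F. height z x = 0"
proof -
  have FV: "F \<subseteq> V" "F \<noteq> {}" using assms cover r_in by auto
  then have fin: "finite (z ` F)" using finite_V finite_subset by blast
  then have "Min (z ` F) \<in> z ` F" using FV by (intro Min_in) auto
  then obtain x where x: "x \<in> F" "z x = Min (z ` F)" by (metis imageE)
  then have "height z x = 0" using cell_eq[OF assms x(1)] by (simp add: height_def)
  then show ?thesis using x(1) by blast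
qed

lemma height_support: "{x. height z x \<noteq> 0} \<in> indep V Fs"
  using height_zero_in_cell by (fastforce simp: indep_def height_def)

lemma height_scale:
  assumes "0 < c"
  shows "height (\<lambda>x. c * z x) x = c * height z x"
proof (cases "x \<in> V")
  case True
  have "c * Min (z ` cell x) = Min ((*) c ` (z ` cell x))"
    using assms finite_cell[OF True] cell(2)[OF True]
    by (intro mono_Min_commute) (auto intro!: monoI)
  then show ?thesis using True by (simp add: height_def image_image right_diff_distrib)
qed (simp add: height_def)

text \<open>The preimage is \<open>\<alpha>\<close> shifted on each cell to vanish at the root.
  Independence of the support provides a zero of \<open>\<alpha>\<close> in every cell, so taking
  heights undoes the shift.\<close>

lemma height_surj:
  assumes "\<And>x. 0 \<le> \<alpha> x" "{x. \<alpha> x \<noteq> 0} \<in> indep V Fs"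
  obtains z where "z \<in> normal" "height z = \<alpha>"
proof
  define z where "z x = (if x \<in> V then \<alpha> x - \<alpha> (root x) else 0)" for x
  show "z \<in> normal"
    unfolding normal_def using root_root by (auto simp: z_def free_def)
  show "height z = \<alpha>"
  proof
    fix x show "height z x = \<alpha> x"
    proof (cases "x \<in> V")
      case True
      have "\<not> cell x \<subseteq> {x. \<alpha> x \<noteq> 0}" using assms(2) cell(1)[OF True] by (auto simp: indep_def)
      then obtain y where y: "y \<in> cell x" "\<alpha> y = 0" by blast
      have zc: "z w = \<alpha> w - \<alpha> (root x)" if "w \<in> cell x" for w
        using that cell_subset[OF True] cell_cell[OF True that] by (auto simp: z_def root_def)
      have "Min (z ` cell x) = - \<alpha> (root x)"
      proof (rule Min_eqI)
        show "finite (z ` cell x)" using finite_cell[OF True] by simp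
        show "- \<alpha> (root x) \<le> w" if "w \<in> z ` cell x" for w
          using that zc assms(1) by auto
        show "- \<alpha> (root x) \<in> z ` cell x" using zc[OF y(1)] y by (intro image_eqI[of _ _ y]) auto
      qed
      then show ?thesis using True by (simp add: height_def z_def)
    next
      case False
      then have "\<alpha> x = 0" using assms(2) by (auto simp: indep_def)
      then show ?thesis using False by (simp add: height_def)
    qed
  qed
qed

lemma continuous_map_height:
  assumes "continuous_map X (powertop_real UNIV) f"
  shows "continuous_map X euclideanreal (\<lambda>x. height (f x) v)"
proof (cases "v \<in> V")
  case True
  have "continuous_map X euclideanreal (\<lambda>x. f x w)" for w
    using assms by (simp add: continuous_map_componentwise_UNIV)
  then have "continuous_map X euclideanreal (\<lambda>x. f x v - Min ((\<lambda>w. f x w) ` cell v))"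
    using finite_cell[OF True] cell(2)[OF True]
    by (intro continuous_map_diff continuous_map_Min) auto
  then show ?thesis using True by (simp add: height_def)
qed (simp add: height_def)

lemma topspace_geom_realization:
  assumes "K \<subseteq> indep V Fs"
  shows "topspace (geom_realization K) =
    {\<alpha>. (\<forall>v. 0 \<le> \<alpha> v) \<and> {v. \<alpha> v \<noteq> 0} \<in> K \<and> sum \<alpha> V = 1}"
proof -
  have "sum \<alpha> {v. \<alpha> v \<noteq> 0} = sum \<alpha> V" if "{v. \<alpha> v \<noteq> 0} \<in> K" for \<alpha> :: "'v \<Rightarrow> real"
    using assms that finite_V by (intro sum.mono_neutral_left) (auto simp: indep_def)
  then show ?thesis by (auto simp: geom_realization_def)
qed

text \<open>Radial projection from the unit sphere of \<^term>\<open>normal\<close>, precomposed with a positively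
  homogeneous involution \<open>\<Psi>\<close> carrying the cone over \<open>K\<close> to the cone \<open>P\<close>.\<close>

lemma geom_realization_homeomorphic:
  fixes e :: "nat \<Rightarrow> 'v" and n :: nat and \<Psi> :: "('v \<Rightarrow> real) \<Rightarrow> 'v \<Rightarrow> real"
  defines "emb \<equiv> \<lambda>x v. if v \<in> free then x (inv_into {..n} e v) else (0::real)"
  assumes K: "K \<subseteq> indep V Fs" and e: "bij_betw e {..n} free"
    and normal: "\<And>z. z \<in> normal \<Longrightarrow> \<Psi> z \<in> normal"
    and inv: "\<And>z. z \<in> normal \<Longrightarrow> \<Psi> (\<Psi> z) = z"
    and scale: "\<And>c z. 0 < c \<Longrightarrow> z \<in> normal \<Longrightarrow> \<Psi> (\<lambda>x. c * z x) = (\<lambda>x. c * \<Psi> z x)"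
    and cont: "\<And>(X :: (nat \<Rightarrow> real) topology) f. continuous_map X (powertop_real UNIV) f
      \<Longrightarrow> continuous_map X (powertop_real UNIV) (\<Psi> \<circ> f)"
    and P: "\<And>z. z \<in> normal \<Longrightarrow> {x. height z x \<noteq> 0} \<in> K \<longleftrightarrow> P (\<Psi> z)"
    and P_scale: "\<And>c z. 0 < c \<Longrightarrow> z \<in> normal \<Longrightarrow> P (\<lambda>x. c * z x) \<longleftrightarrow> P z"
    and closed: "closedin (nsphere n) {x \<in> topspace (nsphere n). P (emb x)}"
  shows "subtopology (nsphere n) {x. P (emb x)} homeomorphic_space geom_realization K"
proof -
  let ?X = "subtopology (nsphere n) {x. P (emb x)}"
  define h where "h x = height (\<Psi> (emb x))" for x
  define f where "f x v = h x v / sum (h x) V" for x v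
  have topX: "topspace ?X = {x. (\<Sum>i\<le>n. (x i)\<^sup>2) = 1 \<and> (\<forall>i>n. x i = 0) \<and> P (emb x)}"
    by (auto simp: topspace_nsphere)
  have XD: "(\<Sum>i\<le>n. (x i)\<^sup>2) = 1" "\<And>i. n < i \<Longrightarrow> x i = 0" "P (emb x)" if "x \<in> topspace ?X" for x
    using that unfolding topX by auto
  have emb_normal: "emb x \<in> normal" for x by (simp add: emb_def normal_def)
  have emb_e: "emb x (e i) = x i" if "i \<le> n" for x i
    using that e by (simp add: emb_def bij_betw_inv_into_left bij_betwE)
  \<comment> \<open>Homogeneity with factor 2 gives a value equal to twice itself.\<close>
  have zero: "\<Psi> (\<lambda>x. 0) = (\<lambda>x. 0)"
  proof
    fix x
    have "(\<lambda>x. 0) \<in> normal" by (simp add: normal_def)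
    from fun_cong[OF scale[OF _ this, of 2], of x] show "\<Psi> (\<lambda>x. 0) x = 0" by simp
  qed
  have height_pos: "0 < sum (height z) V" if z: "z \<in> normal" "z \<noteq> (\<lambda>x. 0)" for z
  proof -
    have "\<exists>x\<in>V. height z x \<noteq> 0"
    proof (rule ccontr)
      assume "\<not> ?thesis"
      then have "z x = 0" for x using height_diff[OF z(1), of x] root_V by simp
      then show False using z(2) by blast
    qed
    then obtain x where "x \<in> V" "0 < height z x"
      using height_nonneg by (metis order_less_le)
    then show ?thesis using finite_V height_nonneg by (intro sum_pos2)
  qed
  have Psi_nonzero: "\<Psi> z \<noteq> (\<lambda>x. 0)" if "z \<in> normal" "z \<noteq> (\<lambda>x. 0)" for z
    using inv[OF that(1)] zero that(2) by metis
  have emb_nonzero: "emb x \<noteq> (\<lambda>x. 0)" if "x \<in> topspace ?X" for x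
  proof
    assume "emb x = (\<lambda>x. 0)"
    then have "x i = 0" if "i \<le> n" for i using emb_e[OF that, of x] by simp
    then show False using XD(1)[OF \<open>x \<in> topspace ?X\<close>] by simp
  qed
  have sum_pos: "0 < sum (h x) V" if "x \<in> topspace ?X" for x
    unfolding h_def by (intro height_pos normal Psi_nonzero emb_normal emb_nonzero that)
  have f_in: "f x \<in> topspace (geom_realization K)" if x: "x \<in> topspace ?X" for x
    unfolding topspace_geom_realization[OF K] mem_Collect_eq
  proof (intro conjI allI)
    show "0 \<le> f x v" for v using height_nonneg sum_pos[OF x] by (simp add: f_def h_def)
    have "{v. f x v \<noteq> 0} = {v. h x v \<noteq> 0}" using sum_pos[OF x] by (simp add: f_def)
    moreover have "{v. h x v \<noteq> 0} \<in> K"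
      unfolding h_def using P[OF normal[OF emb_normal]] inv[OF emb_normal] XD(3)[OF x] by simp
    ultimately show "{v. f x v \<noteq> 0} \<in> K" by simp
    show "sum (f x) V = 1" using sum_pos[OF x] by (simp add: f_def flip: sum_divide_distrib)
  qed
  have "homeomorphic_map ?X (geom_realization K) f"
  proof (rule continuous_imp_homeomorphic_map)
    show "compact_space ?X" using closed by (rule compact_space_subtopology_nsphere)
    show "Hausdorff_space (geom_realization K)"
      unfolding geom_realization_def by (intro Hausdorff_space_subtopology Hausdorff_powertop_real)
    have "continuous_map ?X euclideanreal (\<lambda>x. emb x v)" for v
      unfolding emb_def using continuous_map_from_subtopology[OF continuous_map_nsphere_projection]
      by (cases "v \<in> free") auto
    then have "continuous_map ?X (powertop_real UNIV) emb"
      by (simp add: continuous_map_componentwise_UNIV)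
    then have h: "continuous_map ?X euclideanreal (\<lambda>x. h x v)" for v
      using continuous_map_height[OF cont] by (simp add: h_def)
    have "continuous_map ?X euclideanreal (\<lambda>x. sum (h x) V)"
      by (intro continuous_map_sum finite_V h)
    moreover have "sum (h x) V \<noteq> 0" if "x \<in> topspace ?X" for x
      using sum_pos[OF that] by simp
    ultimately have "continuous_map ?X euclideanreal (\<lambda>x. f x v)" for v
      unfolding f_def by (intro continuous_map_real_divide h)
    then have "continuous_map ?X (powertop_real UNIV) f"
      by (simp add: continuous_map_componentwise_UNIV)
    then show "continuous_map ?X (geom_realization K) f"
      using f_in unfolding geom_realization_def continuous_map_in_subtopology by auto
    show "inj_on f (topspace ?X)"
    proof (rule inj_onI)
      fix x y assume x: "x \<in> topspace ?X" and y: "y \<in> topspace ?X" and eq: "f x = f y"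
      \<comment> \<open>Equal images have proportional heights. Homogeneity and the involution carry
        the factor \<open>c\<close> back to \<open>x\<close> and \<open>y\<close>, and two
        positively proportional unit vectors coincide.\<close>
      define c where "c = sum (h x) V / sum (h y) V"
      have c: "0 < c" using sum_pos x y by (simp add: c_def)
      have "h x v = c * h y v" for v
        using fun_cong[OF eq, of v] sum_pos[OF x] sum_pos[OF y]
        by (simp add: f_def c_def field_simps)
      then have "\<Psi> (emb x) = (\<lambda>v. c * \<Psi> (emb y) v)"
        using height_diff[OF normal[OF emb_normal], of x] height_diff[OF normal[OF emb_normal], of y]
        by (auto simp: h_def right_diff_distrib fun_eq_iff)
      then have "\<Psi> (\<Psi> (emb x)) = (\<lambda>v. c * \<Psi> (\<Psi> (emb y)) v)"
        using scale[OF c normal[OF emb_normal]] by simp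
      then have "emb x v = c * emb y v" for v using inv[OF emb_normal] by (simp add: fun_eq_iff)
      then have xy: "x i = c * y i" if "i \<le> n" for i using emb_e[OF that] by metis
      then have "(\<Sum>i\<le>n. (x i)\<^sup>2) = c\<^sup>2 * (\<Sum>i\<le>n. (y i)\<^sup>2)"
        by (simp add: power_mult_distrib sum_distrib_left)
      then have "c = 1" using XD(1)[OF x] XD(1)[OF y] c by (simp add: power2_eq_1_iff)
      then have "x i = y i" for i using xy[of i] XD(2)[OF x, of i] XD(2)[OF y, of i] by (cases "i \<le> n") simp_all
      then show "x = y" by blast
    qed
    show "f ` topspace ?X = topspace (geom_realization K)"
    proof (intro equalityI subsetI)
      fix \<alpha> assume "\<alpha> \<in> f ` topspace ?X"
      then show "\<alpha> \<in> topspace (geom_realization K)" using f_in by blast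
    next
      fix \<alpha> assume "\<alpha> \<in> topspace (geom_realization K)"
      then have \<alpha>: "\<And>v. 0 \<le> \<alpha> v" "{v. \<alpha> v \<noteq> 0} \<in> K" "sum \<alpha> V = 1"
        unfolding topspace_geom_realization[OF K] by auto
      obtain z where z: "z \<in> normal" "height z = \<alpha>" using height_surj \<alpha>(1,2) K by blast
      have zw: "z \<noteq> (\<lambda>x. 0)"
      proof
        assume "z = (\<lambda>x. 0)"
        then have "height z x = 0" for x using height_eq_0_iff[of x z] by (cases "x \<in> V") (auto simp: height_def)
        then show False using z(2) \<alpha>(3) by auto
      qed
      \<comment> \<open>Since the map applies \<open>\<Psi>\<close> before taking heights, the
        preimage is \<open>\<Psi> z\<close>, rescaled to length 1 in the coordinates indexed by
        \<open>free\<close>.\<close>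
      define w where "w = \<Psi> z"
      have w: "w \<in> normal" "w \<noteq> (\<lambda>x. 0)" "\<Psi> w = z"
        using normal Psi_nonzero inv z(1) zw by (auto simp: w_def)
      define s where "s = sqrt (\<Sum>i\<le>n. (w (e i))\<^sup>2)"
      have "\<exists>i\<le>n. w (e i) \<noteq> 0"
      proof (rule ccontr)
        assume "\<not> ?thesis"
        then have "w v = 0" if "v \<in> free" for v
          using that e by (metis atMost_iff bij_betw_imp_surj_on imageE)
        then have "w v = 0" for v using w(1) by (cases "v \<in> free") (auto simp: normal_def)
        then show False using w(2) by auto
      qed
      then obtain i where i: "i \<le> n" "w (e i) \<noteq> 0" by blast
      have "(w (e i))\<^sup>2 \<le> (\<Sum>i\<le>n. (w (e i))\<^sup>2)" by (rule member_le_sum) (use i in auto)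
      moreover have "0 < (w (e i))\<^sup>2" using i by simp
      ultimately have s2: "0 < (\<Sum>i\<le>n. (w (e i))\<^sup>2)" by linarith
      then have s: "0 < s" by (simp add: s_def)
      define x where "x i = (if i \<le> n then w (e i) / s else 0)" for i
      have emb_x: "emb x = (\<lambda>v. (1 / s) * w v)"
      proof
        fix v show "emb x v = (1 / s) * w v"
        proof (cases "v \<in> free")
          case True
          then obtain i where "i \<le> n" "v = e i" using e by (metis atMost_iff bij_betw_imp_surj_on imageE)
          then show ?thesis using emb_e by (simp add: x_def)
        next
          case False
          then show ?thesis using w(1) by (simp add: emb_def normal_def)
        qed
      qed
      have "(\<Sum>i\<le>n. (x i)\<^sup>2) = (\<Sum>i\<le>n. (w (e i))\<^sup>2) / s\<^sup>2"
        by (simp add: x_def power_divide sum_divide_distrib)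
      also have "\<dots> = 1" using s2 by (simp add: s_def)
      finally have "(\<Sum>i\<le>n. (x i)\<^sup>2) = 1" .
      moreover have "P (emb x)"
        unfolding emb_x using P[OF z(1)] \<alpha>(2) z(2) P_scale[of "1 / s" w] s w(1) by (simp add: w_def)
      ultimately have "x \<in> topspace ?X" unfolding topX by (simp add: x_def)
      moreover have "f x = \<alpha>"
      proof -
        have "\<Psi> (emb x) = (\<lambda>v. (1 / s) * z v)"
          unfolding emb_x using scale[of "1 / s" w] s w by simp
        then have hx: "h x v = (1 / s) * \<alpha> v" for v
          using height_scale[of "1 / s" z v] s z(2) by (simp add: h_def)
        have "sum (h x) V = 1 / s" using \<alpha>(3) by (simp add: hx flip: sum_divide_distrib)
        then show ?thesis using s by (simp add: f_def fun_eq_iff hx)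
      qed
      ultimately show "\<alpha> \<in> f ` topspace ?X" by blast
    qed
  qed
  then show ?thesis by (rule homeomorphic_map_imp_homeomorphic_space)
qed

lemma nsphere_homeomorphic_join:
  assumes "card free = Suc n"
  shows "geom_realization (indep V Fs) homeomorphic_space nsphere n"
proof -
  have "finite free" using finite_V by (simp add: free_def)
  then obtain e where "bij_betw e {0..<Suc n} free" using ex_bij_betw_nat_finite assms by metis
  then have e: "bij_betw e {..n} free" by (simp add: atLeast0LessThan lessThan_Suc_atMost)
  have "subtopology (nsphere n) {x. True} homeomorphic_space geom_realization (indep V Fs)"
    by (rule geom_realization_homeomorphic[OF order_refl e, where \<Psi> = "\<lambda>z. z" and P = "\<lambda>_. True"])
       (use height_support in \<open>auto simp: comp_def\<close>)
  then have "nsphere n homeomorphic_space geom_realization (indep V Fs)" by simp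
  then show ?thesis by (rule homeomorphic_space_sym[THEN iffD1])
qed

text \<open>Let \<open>w x\<close> count the members of \<open>S\<close> containing \<open>x\<close>, and let \<open>d\<close> be its drop from the chosen
  point of the cell. Since \<open>w x > w y\<close> whenever \<open>x\<close> lies in the trace of some \<open>G \<in> S\<close> and \<open>y\<close> in
  the rest of the cell, moving along \<open>d\<close> pushes the cone over \<open>indep V S\<close> into its
  interior. Hence this cone is \<open>{z. \<tau> z \<ge> 0}\<close> for the function \<open>\<tau>\<close> below, which satisfies
  \<open>\<tau> (z + s d) = \<tau> z + s\<close>, and an involution shearing along \<open>d\<close> turns it into a half-space.\<close>

lemma hemisphere_homeomorphic_indep:
  assumes gr: "grafting Fs S" and SV: "S \<subseteq> Pow V" and nonempty: "{} \<notin> S"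
    and anti: "antichain_sets S" and proper: "S \<noteq> Fs"
    and r_max: "\<And>F x. F \<in> Fs \<Longrightarrow> x \<in> F \<Longrightarrow> card {G \<in> S. x \<in> G} \<le> card {G \<in> S. r F \<in> G}"
  obtains n where "card free = Suc n"
    "geom_realization (indep V S) homeomorphic_space subtopology (nsphere n) {x. x n \<le> 0}"
proof -
  note grD = graftingD[OF gr]
  have finS: "finite S" using SV finite_V by (meson finite_Pow_iff finite_subset)
  \<comment> \<open>Only these members restrict the cone: a height function vanishes somewhere on
    every cell, which settles the members of \<open>Fs\<close>.\<close>
  define A where "A = S - Fs"
  have A: "finite A" "A \<noteq> {}" using finS grD(1) proper by (auto simp: A_def)
  have GA: "G \<in> S" "G \<noteq> {}" "G \<subseteq> V" "finite G" if "G \<in> A" for G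
  proof -
    show "G \<in> S" "G \<noteq> {}" "G \<subseteq> V" using that nonempty SV by (auto simp: A_def)
    then show "finite G" using finite_V finite_subset by blast
  qed
  define w where "w x = real (card {G \<in> S. x \<in> G})" for x
  \<comment> \<open>A member of \<open>S\<close> through \<open>y\<close> has a trace not contained
    in that of \<open>G\<close>, so its trace contains that of \<open>G\<close> and hence
    \<open>x\<close>. \<open>G\<close> itself contains \<open>x\<close> but not \<open>y\<close>,
    which makes the inequality strict.\<close>
  have gap: "w y < w x" if G: "G \<in> A" "x \<in> G" "y \<in> cell x - G" for G x y
  proof -
    have xV: "x \<in> V" using GA(3) G by blast
    have "{H \<in> S. y \<in> H} \<subset> {H \<in> S. x \<in> H}"
    proof
      show "{H \<in> S. y \<in> H} \<subseteq> {H \<in> S. x \<in> H}"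
      proof clarify
        fix H assume H: "H \<in> S" "y \<in> H"
        have "G \<inter> cell x \<subseteq> H \<inter> cell x \<or> H \<inter> cell x \<subseteq> G \<inter> cell x"
          using grD(4)[OF cell(1)[OF xV] GA(1)[OF G(1)] H(1)] .
        then show "x \<in> H" using H G cell(2)[OF xV] by blast
      qed
      show "{H \<in> S. y \<in> H} \<noteq> {H \<in> S. x \<in> H}" using GA(1) G by blast
    qed
    then show ?thesis unfolding w_def using finS by (simp add: psubset_card_mono)
  qed
  have rest: "finite (cell x - G)" "cell x - G \<noteq> {}" if G: "G \<in> A" "x \<in> G" for G x
  proof -
    have xV: "x \<in> V" using GA(3) G by blast
    then show "finite (cell x - G)" using finite_cell by simp
    show "cell x - G \<noteq> {}"
    proof
      assume "cell x - G = {}"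
      then have "cell x = G"
        using anti cell(1)[OF xV] grD(1) GA(1)[OF G(1)] by (auto simp: antichain_sets_def)
      then show False using cell(1)[OF xV] G(1) by (simp add: A_def)
    qed
  qed
  \<comment> \<open>Roots maximize \<open>w\<close> in their cells, so \<open>d\<close> is
    nonnegative; it vanishes at the roots and thus lies in \<open>normal\<close>.\<close>
  define d where "d x = (if x \<in> V then w (root x) - w x else 0)" for x
  have d_nonneg: "0 \<le> d x" for x
    using r_max[OF cell] by (simp add: d_def w_def root_def)
  have d_normal: "d \<in> normal"
    using root_root by (auto simp: normal_def free_def d_def)
  have d_diff: "d y - d x = w x - w y" if "G \<in> A" "x \<in> G" "y \<in> cell x - G" for G x y
  proof -
    have xV: "x \<in> V" using GA(3) that by blast
    moreover have "y \<in> V" "cell y = cell x"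
      using that(3) cell_subset[OF xV] cell_cell[OF xV, of y] by auto
    ultimately show ?thesis by (simp add: d_def root_def)
  qed
  \<comment> \<open>A point with positive \<open>d\<close> gives a linear coordinate that strictly
    increases along \<open>d\<close>; its half-space will be the target of the involution.\<close>
  obtain G0 x0 b0 where b0: "G0 \<in> A" "x0 \<in> G0" "b0 \<in> cell x0 - G0"
    using A(2) GA(2) rest(2) by (metis all_not_in_conv)
  have d_b0: "0 < d b0" using d_diff[OF b0] gap[OF b0] d_nonneg[of x0] by linarith
  then have b0_free: "b0 \<in> free" using d_normal by (auto simp: normal_def)
  \<comment> \<open>\<open>\<mu> z G x\<close> is the largest \<open>s\<close> for which
    \<open>z - s d\<close> is still at \<open>x\<close> at most its values on the part of the cell
    outside \<open>G\<close>. Taking the best \<open>x\<close> for each \<open>G\<close> and the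
    worst \<open>G\<close>, \<open>\<tau> z\<close> becomes the largest \<open>s\<close> with
    \<open>z - s d\<close> in the cone.\<close>
  define \<mu> where "\<mu> z G x = Min ((\<lambda>y. (z y - z x) / (w x - w y)) ` (cell x - G))" for z :: "'v \<Rightarrow> real" and G x
  define \<tau> where "\<tau> z = Min ((\<lambda>G. Max ((\<lambda>x. \<mu> z G x) ` G)) ` A)" for z
  have mu_nonneg: "0 \<le> \<mu> z G x \<longleftrightarrow> (\<forall>y\<in>cell x - G. z x \<le> z y)" if "G \<in> A" "x \<in> G" for z G x
  proof -
    have "0 \<le> \<mu> z G x \<longleftrightarrow> (\<forall>y\<in>cell x - G. 0 \<le> (z y - z x) / (w x - w y))"
      unfolding \<mu>_def using rest[OF that] by simp
    also have "\<dots> \<longleftrightarrow> (\<forall>y\<in>cell x - G. z x \<le> z y)"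
    proof (intro ball_cong refl)
      fix y assume "y \<in> cell x - G"
      from gap[OF that this] show "0 \<le> (z y - z x) / (w x - w y) \<longleftrightarrow> z x \<le> z y"
        by (auto simp: zero_le_divide_iff)
    qed
    finally show ?thesis .
  qed
  have tau_nonneg: "0 \<le> \<tau> z \<longleftrightarrow> (\<forall>G\<in>A. \<exists>x\<in>G. height z x = 0)" for z
  proof -
    have "0 \<le> \<tau> z \<longleftrightarrow> (\<forall>G\<in>A. 0 \<le> Max ((\<lambda>x. \<mu> z G x) ` G))"
      unfolding \<tau>_def using A by simp
    also have "\<dots> \<longleftrightarrow> (\<forall>G\<in>A. \<exists>x\<in>G. 0 \<le> \<mu> z G x)"
      using GA(2,4) by (intro ball_cong refl) (simp add: Max_ge_iff)
    also have "\<dots> \<longleftrightarrow> (\<forall>G\<in>A. \<exists>x\<in>G. height z x = 0)"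
    proof (intro ball_cong refl iffI)
      fix G assume G: "G \<in> A" and "\<exists>x\<in>G. 0 \<le> \<mu> z G x"
      then obtain x where x: "x \<in> G" "\<forall>y\<in>cell x - G. z x \<le> z y" using mu_nonneg by blast
      have xV: "x \<in> V" using GA(3) G x by blast
      \<comment> \<open>The quotients compare \<open>x\<close> only with points of its cell outside
        \<open>G\<close>. A minimum point \<open>x'\<close> of the whole cell either lies in
        \<open>G\<close>, or lies outside and then \<open>x\<close> attains the minimum as
        well.\<close>
      obtain x' where x': "x' \<in> cell x" "height z x' = 0"
        using height_zero_in_cell cell(1)[OF xV] by blast
      then have x'V: "x' \<in> V" and c: "cell x' = cell x" using cell_subset cell_cell xV by blast+
      have min: "\<forall>y\<in>cell x. z x' \<le> z y" using x'(2) height_eq_0_iff[OF x'V] c by simp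
      show "\<exists>x\<in>G. height z x = 0"
      proof (cases "x' \<in> G")
        case False
        then have "z x \<le> z x'" using x x' by blast
        then have "\<forall>y\<in>cell x. z x \<le> z y" using min order_trans by blast
        then show ?thesis using x(1) height_eq_0_iff[OF xV] by blast
      qed (use x' in blast)
    next
      fix G assume G: "G \<in> A" and "\<exists>x\<in>G. height z x = 0"
      then obtain x where x: "x \<in> G" "height z x = 0" by blast
      have xV: "x \<in> V" using GA(3) G x by blast
      then show "\<exists>x\<in>G. 0 \<le> \<mu> z G x" using mu_nonneg[OF G x(1)] height_eq_0_iff[OF xV] x by blast
    qed
    finally show ?thesis .
  qed
  have mu_shift: "\<mu> (\<lambda>x. z x + s * d x) G x = \<mu> z G x + s" if G: "G \<in> A" "x \<in> G" for z s G x
  proof -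
    have "(z y + s * d y - (z x + s * d x)) / (w x - w y) = (z y - z x) / (w x - w y) + s"
      if y: "y \<in> cell x - G" for y
    proof -
      have "z y + s * d y - (z x + s * d x) = (z y - z x) + s * (d y - d x)" by (simp add: algebra_simps)
      also have "\<dots> = (z y - z x) + s * (w x - w y)" by (simp only: d_diff[OF G y])
      finally show ?thesis using gap[OF G y] by (simp only: add_divide_distrib) simp
    qed
    then have "(\<lambda>y. (z y + s * d y - (z x + s * d x)) / (w x - w y)) ` (cell x - G) =
      (\<lambda>y. (z y - z x) / (w x - w y) + s) ` (cell x - G)" by (intro image_cong) auto
    then show ?thesis unfolding \<mu>_def using Min_add_commute[OF rest[OF G]] by simp
  qed
  have tau_shift: "\<tau> (\<lambda>x. z x + s * d x) = \<tau> z + s" for z s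
  proof -
    have "Max ((\<lambda>x. \<mu> (\<lambda>x. z x + s * d x) G x) ` G) = Max ((\<lambda>x. \<mu> z G x) ` G) + s" if G: "G \<in> A" for G
    proof -
      have "(\<lambda>x. \<mu> (\<lambda>x. z x + s * d x) G x) ` G = (\<lambda>x. \<mu> z G x + s) ` G"
        using mu_shift[OF G] by (intro image_cong) auto
      then show ?thesis using Max_add_commute[OF GA(4,2)[OF G]] by simp
    qed
    then have "(\<lambda>G. Max ((\<lambda>x. \<mu> (\<lambda>x. z x + s * d x) G x) ` G)) ` A = (\<lambda>G. Max ((\<lambda>x. \<mu> z G x) ` G) + s) ` A"
      by (intro image_cong) auto
    then show ?thesis unfolding \<tau>_def using Min_add_commute[OF A] by simp
  qed
  have tau_scale: "\<tau> (\<lambda>x. c * z x) = c * \<tau> z" if c: "0 < c" for c z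
  proof -
    have m: "mono ((*) c)" using c by (auto intro!: monoI)
    have mu: "\<mu> (\<lambda>x. c * z x) G x = c * \<mu> z G x" if G: "G \<in> A" "x \<in> G" for G x
      unfolding \<mu>_def using mono_Min_commute[OF m, of "(\<lambda>y. (z y - z x) / (w x - w y)) ` (cell x - G)"] rest[OF G]
      by (simp add: image_image right_diff_distrib)
    have "Max ((\<lambda>x. \<mu> (\<lambda>x. c * z x) G x) ` G) = c * Max ((\<lambda>x. \<mu> z G x) ` G)" if G: "G \<in> A" for G
    proof -
      have "(\<lambda>x. \<mu> (\<lambda>x. c * z x) G x) ` G = (\<lambda>x. c * \<mu> z G x) ` G"
        using mu[OF G] by (intro image_cong) auto
      then show ?thesis
        using mono_Max_commute[OF m, of "(\<lambda>x. \<mu> z G x) ` G"] GA[OF G] by (simp add: image_image)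
    qed
    then have "(\<lambda>G. Max ((\<lambda>x. \<mu> (\<lambda>x. c * z x) G x) ` G)) ` A = (\<lambda>G. c * Max ((\<lambda>x. \<mu> z G x) ` G)) ` A"
      by (intro image_cong) auto
    then show ?thesis
      unfolding \<tau>_def using mono_Min_commute[OF m, of "(\<lambda>G. Max ((\<lambda>x. \<mu> z G x) ` G)) ` A"] A
      by (simp add: image_image)
  qed
  \<comment> \<open>Along a line in direction \<open>d\<close> both \<open>\<tau> z\<close> and
    \<open>z b0 / d b0\<close> grow at unit rate. \<open>\<Psi>\<close> reflects the line at the
    point where they sum to zero, so it interchanges them with a change of sign; this makes it an
    involution.\<close>
  define \<Psi> where "\<Psi> z x = z x + - (\<tau> z + z b0 / d b0) * d x" for z x
  have Psi_b0: "\<Psi> z b0 = - \<tau> z * d b0" for z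
    using d_b0 by (simp add: \<Psi>_def field_simps)
  have tau_Psi: "\<tau> (\<Psi> z) = - (z b0 / d b0)" for z
    using tau_shift[of z "- (\<tau> z + z b0 / d b0)"] by (simp add: \<Psi>_def[abs_def])
  \<comment> \<open>The enumeration places \<open>b0\<close> last, so that the half-space cut out by
    \<open>b0\<close> becomes the lower hemisphere.\<close>
  obtain n e where n: "card free = Suc n" and e: "bij_betw e {..n} free" "e n = b0"
  proof -
    have fin: "finite free" using finite_V by (simp add: free_def)
    then have "card free \<noteq> 0" using b0_free by auto
    then obtain n where n: "card free = Suc n" using not0_implies_Suc by blast
    then have "card (free - {b0}) = n" using b0_free fin by simp
    then obtain e where "bij_betw e {0..<n} (free - {b0})"
      using ex_bij_betw_nat_finite fin finite_Diff by metis
    then have "bij_betw (e(n := b0)) {..<n} (free - {b0})"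
      unfolding atLeast0LessThan by (rule bij_betw_cong[THEN iffD1, rotated]) auto
    then have "bij_betw (e(n := b0)) ({..<n} \<union> {n}) ((free - {b0}) \<union> {(e(n := b0)) n})"
      using notIn_Un_bij_betw3[of n "{..<n}" "e(n := b0)" "free - {b0}"] by simp
    moreover have "{..<n} \<union> {n} = {..n}" by auto
    moreover have "(free - {b0}) \<union> {(e(n := b0)) n} = free" using b0_free by auto
    ultimately show ?thesis using that[OF n, of "e(n := b0)"] by simp
  qed
  have emb_b0: "inv_into {..n} e b0 = n" using e by (metis atMost_iff bij_betw_inv_into_left order_refl)
  have "subtopology (nsphere n) {x. (\<lambda>v. if v \<in> free then x (inv_into {..n} e v) else 0) b0 \<le> (0::real)}
      homeomorphic_space geom_realization (indep V S)"
  proof (rule geom_realization_homeomorphic[OF _ e(1), where \<Psi> = \<Psi> and P = "\<lambda>z. z b0 \<le> 0"])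
    show "indep V S \<subseteq> indep V Fs" using grD(1) by (auto simp: indep_def)
    show "\<Psi> z \<in> normal" if "z \<in> normal" for z
      using that d_normal by (simp add: normal_def \<Psi>_def)
    show "\<Psi> (\<Psi> z) = z" for z
    proof
      fix x
      have "\<Psi> (\<Psi> z) x = \<Psi> z x + - (\<tau> (\<Psi> z) + \<Psi> z b0 / d b0) * d x" by (simp add: \<Psi>_def[of "\<Psi> z"])
      also have "\<dots> = \<Psi> z x + (z b0 / d b0 + \<tau> z) * d x"
        unfolding tau_Psi Psi_b0 using d_b0 by simp
      also have "\<dots> = z x" by (simp add: \<Psi>_def algebra_simps)
      finally show "\<Psi> (\<Psi> z) x = z x" .
    qed
    show "\<Psi> (\<lambda>x. c * z x) = (\<lambda>x. c * \<Psi> z x)" if "0 < c" for c z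
      using that tau_scale[OF that] by (simp add: \<Psi>_def fun_eq_iff algebra_simps)
    show "continuous_map X (powertop_real UNIV) (\<Psi> \<circ> f)"
      if "continuous_map X (powertop_real UNIV) f" for X :: "(nat \<Rightarrow> real) topology" and f
    proof -
      have f: "continuous_map X euclideanreal (\<lambda>x. f x v)" for v
        using that by (simp add: continuous_map_componentwise_UNIV)
      have "continuous_map X euclideanreal (\<lambda>p. \<mu> (f p) G x)" if "G \<in> A" "x \<in> G" for G x
        unfolding \<mu>_def
      proof (rule continuous_map_Min[OF rest[OF that]])
        fix y assume "y \<in> cell x - G"
        then have "w x - w y \<noteq> 0" using gap[OF that] by force
        then show "continuous_map X euclideanreal (\<lambda>p. (f p y - f p x) / (w x - w y))"
          by (intro continuous_map_real_divide continuous_map_diff f) auto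
      qed
      then have "continuous_map X euclideanreal (\<lambda>p. \<tau> (f p))"
        unfolding \<tau>_def using A GA(2,4) by (intro continuous_map_Min continuous_map_Max)
      then have "continuous_map X euclideanreal (\<lambda>p. \<Psi> (f p) v)" for v
        unfolding \<Psi>_def using d_b0
        by (intro continuous_map_add continuous_map_real_mult continuous_map_minus
            continuous_map_real_divide f) auto
      then show ?thesis by (simp add: continuous_map_componentwise_UNIV)
    qed
    show "{x. height z x \<noteq> 0} \<in> indep V S \<longleftrightarrow> \<Psi> z b0 \<le> 0" if "z \<in> normal" for z
    proof -
      have "{x. height z x \<noteq> 0} \<in> indep V S \<longleftrightarrow> (\<forall>G\<in>A. \<exists>x\<in>G. height z x = 0)"
        using height_support[of z] unfolding indep_def A_def by blast
      also have "\<dots> \<longleftrightarrow> 0 \<le> \<tau> z" by (simp add: tau_nonneg)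
      also have "\<dots> \<longleftrightarrow> \<Psi> z b0 \<le> 0" unfolding Psi_b0 using d_b0 by (simp add: zero_le_mult_iff)
      finally show ?thesis .
    qed
    show "c * z b0 \<le> 0 \<longleftrightarrow> z b0 \<le> 0" if "0 < c" for c :: real and z :: "'v \<Rightarrow> real"
      using that by (simp add: mult_le_0_iff)
    show "closedin (nsphere n) {x \<in> topspace (nsphere n).
        (if b0 \<in> free then x (inv_into {..n} e b0) else 0) \<le> 0}"
      using closedin_lower_hemisphere b0_free emb_b0 by simp
  qed
  then have "subtopology (nsphere n) {x. x n \<le> 0} homeomorphic_space geom_realization (indep V S)"
    using b0_free emb_b0 by simp
  then show ?thesis by (rule that[OF n homeomorphic_space_sym[THEN iffD1]])
qed

end

lemma indep_singletons:
  assumes "\<Union>Fs = V" "\<And>F. F \<in> Fs \<Longrightarrow> \<exists>x. F = {x}"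
  shows "indep V Fs = {{}}"
proof (intro equalityI subsetI)
  fix W assume W: "W \<in> indep V Fs"
  have "x \<notin> W" for x
  proof
    assume "x \<in> W"
    then obtain F where "F \<in> Fs" "x \<in> F" using W assms(1) by (auto simp: indep_def)
    then show False using assms(2)[of F] \<open>x \<in> W\<close> W by (auto simp: indep_def)
  qed
  then show "W \<in> {{}}" by blast
next
  fix W :: "'a set" assume "W \<in> {{}}"
  then show "W \<in> indep V Fs" using assms(2) by (auto simp: indep_def)
qed

text \<open>Each root is chosen in the largest number of members of \<open>S\<close>, so that the
  later shear direction is nonnegative.\<close>

lemma exists_cells:
  assumes "finite V" "S \<subseteq> Pow V" "grafting Fs S" "{} \<notin> S" "\<Union>Fs = V"
  obtains r where "cells V Fs r"
    "\<And>F x. F \<in> Fs \<Longrightarrow> x \<in> F \<Longrightarrow> card {G \<in> S. x \<in> G} \<le> card {G \<in> S. r F \<in> G}"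
proof -
  note gr = graftingD[OF assms(3)]
  have "\<exists>y\<in>F. \<forall>x\<in>F. card {G \<in> S. x \<in> G} \<le> card {G \<in> S. y \<in> G}" if F: "F \<in> Fs" for F
  proof -
    let ?c = "\<lambda>x. card {G \<in> S. x \<in> G}"
    have "F \<subseteq> V" "F \<noteq> {}" using F gr(1) assms(2,4) by auto
    then have fin: "finite (?c ` F)" using assms(1) finite_subset by blast
    then have "Max (?c ` F) \<in> ?c ` F" using \<open>F \<noteq> {}\<close> by (intro Max_in) auto
    then obtain y where y: "y \<in> F" "Max (?c ` F) = ?c y" by (rule imageE)
    then have "?c x \<le> ?c y" if "x \<in> F" for x
      using Max_ge[OF fin, of "?c x"] that by simp
    then show ?thesis using y(1) by blast
  qed
  then obtain r where r: "\<And>F. F \<in> Fs \<Longrightarrow> r F \<in> F"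
    "\<And>F x. F \<in> Fs \<Longrightarrow> x \<in> F \<Longrightarrow> card {G \<in> S. x \<in> G} \<le> card {G \<in> S. r F \<in> G}" by metis
  have "cells V Fs r" using assms(1,5) gr(3) r(1) by unfold_locales
  then show ?thesis using that r(2) by blast
qed

lemma simplicial_sphere_indep:
  assumes "finite V" "S \<subseteq> Pow V" "grafting S S" "{} \<notin> S" "\<Union>S = V"
  shows "simplicial_sphere (indep V S)"
proof -
  obtain r where "cells V S r" using exists_cells[OF assms] by metis
  then interpret cells V S r .
  show ?thesis
  proof (cases "card free")
    \<comment> \<open>Without free points every cell is a singleton, and the complex is the
      (-1)-sphere.\<close>
    case 0
    then have V: "V = r ` S" using finite_V cover r_in by (auto simp: free_def)
    have "F = {r F}" if F: "F \<in> S" for F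
    proof -
      have "y = r F" if y: "y \<in> F" for y
      proof -
        obtain F' where "F' \<in> S" "y = r F'" using y F cover V by blast
        then show ?thesis using disjoint[OF F, of F'] y r_in by blast
      qed
      then show ?thesis using r_in[OF F] by blast
    qed
    then have "indep V S = {{}}" using cover by (intro indep_singletons) blast+
    then have "simplicial_sphere_of_dim (-1) (indep V S)" by (simp add: simplicial_sphere_of_dim_def)
    then show ?thesis by (auto simp: simplicial_sphere_def)
  next
    case (Suc n)
    have "simplicial_sphere_of_dim (int n) (indep V S)"
      using nsphere_homeomorphic_join[OF Suc] by (simp add: simplicial_sphere_of_dim_def)
    then show ?thesis by (auto simp: simplicial_sphere_def)
  qed
qed

text \<open>A closed hemisphere is contractible, which excludes spheres of dimension at least 0. The
  (-1)-sphere has empty realization, whereas the hemisphere contains the south pole.\<close>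

lemma simplicial_ball_indep:
  assumes "finite V" "S \<subseteq> Pow V" "grafting Fs S" "{} \<notin> S" "\<Union>Fs = V" "antichain_sets S" "S \<noteq> Fs"
  shows "simplicial_ball (indep V S)" "\<not> simplicial_sphere (indep V S)"
proof -
  obtain r where "cells V Fs r"
    and r: "\<And>F x. F \<in> Fs \<Longrightarrow> x \<in> F \<Longrightarrow> card {G \<in> S. x \<in> G} \<le> card {G \<in> S. r F \<in> G}"
    using exists_cells[OF assms(1-5)] by metis
  then interpret cells V Fs r by simp
  obtain n where n: "geom_realization (indep V S) homeomorphic_space subtopology (nsphere n) {x. x n \<le> 0}"
    using hemisphere_homeomorphic_indep[OF assms(3,2,4,6,7) r] by metis
  then have "geom_realization (indep V S) homeomorphic_space closed_ball_space n"
    using hemisphere_homeomorphic_ball homeomorphic_space_trans by metis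
  then show "simplicial_ball (indep V S)"
    by (auto simp: simplicial_ball_def simplicial_ball_of_dim_def)
  show "\<not> simplicial_sphere (indep V S)"
  proof
    assume "simplicial_sphere (indep V S)"
    then obtain d where d: "simplicial_sphere_of_dim d (indep V S)" by (auto simp: simplicial_sphere_def)
    show False
    proof (cases "d = -1")
      case True
      then have "indep V S = {{}}" using d by (simp add: simplicial_sphere_of_dim_def)
      then have "topspace (geom_realization (indep V S)) = {}"
        by (auto simp: geom_realization_def)
      then have "geom_realization (indep V S) = trivial_topology" by simp
      then have "topspace (subtopology (nsphere n) {x. x n \<le> 0}) = {}"
        using homeomorphic_empty_space[OF n] by simp
      moreover have "(\<lambda>i. if i = n then -1 else 0) \<in> topspace (subtopology (nsphere n) {x. x n \<le> 0})"
        by (simp add: topspace_nsphere if_distrib[where f = "\<lambda>x. x\<^sup>2"] cong: if_cong)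
      ultimately show False by blast
    next
      case False
      then have "geom_realization (indep V S) homeomorphic_space nsphere (nat d)"
        using d by (simp add: simplicial_sphere_of_dim_def)
      then have "subtopology (nsphere n) {x. x n \<le> 0} homeomorphic_space nsphere (nat d)"
        using n homeomorphic_space_trans homeomorphic_space_sym by metis
      then have "contractible_space (nsphere (nat d))"
        using homeomorphic_space_contractibility contractible_space_lower_hemisphere[of n n] by blast
      then show False using non_contractible_space_nsphere by blast
    qed
  qed
qed

section \<open>The equivalence theorem\<close>

theorem theorem3p4:
  fixes V :: "'v set" and D \<Gamma> :: "'v set set" and I :: "('v, 'k::field) mpoly set"
  assumes "finite V" and "V \<noteq> {}"
    and "simplicial_complex V D" and "\<Union>D = V"
    and "\<Gamma> = Ind V D"
    and "I = facet_ideal V D"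
  shows
    "I = SR_ideal V \<Gamma> \<and>
     (grafted D \<longleftrightarrow> generalized_Bier_ball TYPE('k) V \<Gamma>) \<and>
     (generalized_Bier_ball TYPE('k) V \<Gamma> \<longleftrightarrow>
        (\<exists>(m::nat) (J :: (nat, 'k) mpoly set).
           artinian_monomial_ideal {1..m} J \<and> is_polarization_of V I {1..m} J)) \<and>
     (\<forall>(m::nat) (J :: (nat, 'k) mpoly set) (a :: nat \<Rightarrow> nat) (A :: (nat \<Rightarrow>\<^sub>0 nat) set).
        is_polarization_of V I {1..m} J \<and>
        minimally_generates {1..m} ((\<lambda>i. Poly_Mapping.single i (a i)) ` {1..m} \<union> A) J \<and>
        (\<lambda>i. Poly_Mapping.single i (a i)) ` {1..m} \<inter> A = {} \<longrightarrow>
          vertex_decomposable \<Gamma> \<and>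
          dim_complex \<Gamma> = (\<Sum>i = 1..m. int (a i)) - int m - 1 \<and>
          (simplicial_sphere \<Gamma> \<longleftrightarrow> A = {}) \<and>
          (A \<noteq> {} \<longrightarrow> simplicial_ball \<Gamma>))"
proof -
  note finV = assms(1)
  have DV: "D \<subseteq> Pow V" using assms(3) by (simp add: simplicial_complex_def)
  have finD: "finite D" using DV finV by (meson finite_Pow_iff finite_subset)
  define S where "S = facets D"
  have SV: "S \<subseteq> Pow V" using DV facets_subset by (auto simp: S_def)
  have finS: "finite S" using SV finV by (meson finite_Pow_iff finite_subset)
  have anti: "antichain_sets S" by (simp add: S_def antichain_facets)
  have coverS: "\<Union>S = V"
  proof
    show "V \<subseteq> \<Union>S"
    proof
      fix x assume "x \<in> V"
      then obtain A where "A \<in> D" "x \<in> A" using assms(4) by blast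
      then show "x \<in> \<Union>S" using face_subset_facet[OF finD, of A] by (metis S_def UnionI subsetD)
    qed
  qed (use SV in blast)
  \<comment> \<open>An empty facet would be the only one, so no vertex could be covered, although
    \<open>V\<close> is nonempty.\<close>
  have nonempty: "{} \<notin> S"
  proof
    assume "{} \<in> S"
    then have "F = {}" if "F \<in> S" for F using that anti by (auto simp: antichain_sets_def)
    then show False using coverS assms(2) by auto
  qed
  have \<Gamma>: "\<Gamma> = indep V S" using assms(5) by (simp add: Ind_eq_indep S_def)
  have D: "complex_of S = D" unfolding S_def by (rule complex_of_facets[OF finD assms(3)])
  have I_SR: "I = SR_ideal V \<Gamma>"
    by (simp add: assms(6) \<Gamma> facet_ideal_eq[OF finV DV] SR_ideal_indep[OF finV SV] flip: S_def)
  have pol: "is_polarization_of V I X J \<longleftrightarrow>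
      (\<exists>\<sigma>. bij_betw \<sigma> (\<Union>(polset ` M)) V \<and> S = image \<sigma> ` polset ` M)"
    if "minimally_generates X M J" for X :: "nat set" and M and J :: "(nat, 'k) mpoly set"
    unfolding S_def by (rule is_polarization_of_iff[OF finV DV assms(6) that])
  have min_gens: "minimally_generates X (min_gens X J) J"
    if "artinian_monomial_ideal X J" for X :: "nat set" and J :: "(nat, 'k) mpoly set"
    using that by (intro minimally_generates_min_gens) (simp add: artinian_monomial_ideal_def)
  let ?c = "\<exists>(m::nat) (J :: (nat, 'k) mpoly set).
    artinian_monomial_ideal {1..m} J \<and> is_polarization_of V I {1..m} J"
  \<comment> \<open>The equivalence holds for each \<open>m\<close> and \<open>J\<close> separately,
    so the same ideal witnesses both sides.\<close>
  have "generalized_Bier_ball TYPE('k) V \<Gamma> \<longleftrightarrow> ?c"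
    unfolding generalized_Bier_ball_def
  proof (intro ex_cong1 conj_cong refl)
    fix m and J :: "(nat, 'k) mpoly set" assume J: "artinian_monomial_ideal {1..m} J"
    show "complex_iso (pol_vars {1..m} J) (SR_complex (pol_vars {1..m} J) (polarization {1..m} J)) V \<Gamma>
      \<longleftrightarrow> is_polarization_of V I {1..m} J"
      unfolding pol[OF min_gens[OF J]] assms(5) S_def
      by (rule complex_iso_polarization_iff[OF finV DV min_gens[OF J]])
  qed
  moreover have "grafted D \<longleftrightarrow> ?c"
  proof
    assume "grafted D"
    then obtain Fs where gr: "grafting Fs S" using grafted_imp_grafting by (auto simp: S_def)
    have "\<Union>Fs = V" using graftingD(1,2)[OF gr] coverS by blast
    then obtain m :: nat and M \<sigma> where M: "M \<subseteq> mons_on {1..m}" "\<forall>s\<in>M. \<forall>t\<in>M. mdvd s t \<longrightarrow> s = t"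
      "\<forall>i\<in>{1..m}. \<exists>a. Poly_Mapping.single i a \<in> M"
      and \<sigma>: "bij_betw \<sigma> (\<Union>(polset ` M)) V" "S = image \<sigma> ` polset ` M"
      using grafting_polarization[OF finV anti gr _ SV] by metis
    define J :: "(nat, 'k) mpoly set" where "J = {p. keys p \<subseteq> upset {1..m} M}"
    have gen: "minimally_generates {1..m} M J"
      unfolding minimally_generates_iff using M(1,2) by (simp add: J_def)
    have "artinian_monomial_ideal {1..m} J" unfolding artinian_iff[OF gen] by (rule M(3))
    moreover have "is_polarization_of V I {1..m} J" unfolding pol[OF gen] using \<sigma> by blast
    ultimately show ?c by blast
  next
    assume ?c
    then obtain m and J :: "(nat, 'k) mpoly set"
      where J: "artinian_monomial_ideal {1..m} J" "is_polarization_of V I {1..m} J" by blast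
    define M where "M = min_gens {1..m} J"
    have gen: "minimally_generates {1..m} M J" unfolding M_def by (rule min_gens[OF J(1)])
    have M: "M \<subseteq> mons_on {1..m}" "\<forall>s\<in>M. \<forall>t\<in>M. mdvd s t \<longrightarrow> s = t"
      using gen by (simp_all add: minimally_generates_iff)
    obtain \<sigma> where \<sigma>: "bij_betw \<sigma> (\<Union>(polset ` M)) V" "S = image \<sigma> ` polset ` M"
      using J(2) pol[OF gen] by blast
    have "\<forall>i\<in>{1..m}. \<exists>a. Poly_Mapping.single i a \<in> M" using J(1) artinian_iff[OF gen] by blast
    then obtain a where a: "\<And>i. i \<in> {1..m} \<Longrightarrow> Poly_Mapping.single i (a i) \<in> M" by metis
    have "\<exists>Fs. grafting Fs S"
      using polarization_grafting(1)[OF _ assms(2) \<sigma>(1) M a] \<sigma>(2) by auto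
    then show "grafted D" using grafting_imp_grafted[OF finS anti nonempty] D by auto
  qed
  moreover have "vertex_decomposable \<Gamma> \<and> dim_complex \<Gamma> = (\<Sum>i = 1..m. int (a i)) - int m - 1 \<and>
      (simplicial_sphere \<Gamma> \<longleftrightarrow> A = {}) \<and> (A \<noteq> {} \<longrightarrow> simplicial_ball \<Gamma>)"
    if J: "is_polarization_of V I {1..m} J"
      and gen: "minimally_generates {1..m} ((\<lambda>i. Poly_Mapping.single i (a i)) ` {1..m} \<union> A) J"
      and disj: "(\<lambda>i. Poly_Mapping.single i (a i)) ` {1..m} \<inter> A = {}"
    for m and J :: "(nat, 'k) mpoly set" and a A
  proof -
    let ?P = "(\<lambda>i. Poly_Mapping.single i (a i)) ` {1..m}"
    define M where "M = ?P \<union> A"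
    have M: "M \<subseteq> mons_on {1..m}" "\<forall>s\<in>M. \<forall>t\<in>M. mdvd s t \<longrightarrow> s = t"
      using gen by (simp_all add: minimally_generates_iff M_def)
    obtain \<sigma> where \<sigma>: "bij_betw \<sigma> (\<Union>(polset ` M)) V" "S = image \<sigma> ` polset ` M"
      using J pol[OF gen] unfolding M_def by blast
    have a: "Poly_Mapping.single i (a i) \<in> M" if "i \<in> {1..m}" for i using that by (simp add: M_def)
    define Fs where "Fs = (\<lambda>i. \<sigma> ` polset (Poly_Mapping.single i (a i))) ` {1..m}"
    note pg = polarization_grafting[OF finite_atLeastAtMost assms(2) \<sigma>(1) M a]
    have gr: "grafting Fs S" and cover: "\<Union>Fs = V"
      using pg(1,2) \<sigma>(2) by (simp_all add: Fs_def)
    have "card Fs = m" unfolding Fs_def using card_image[OF pg(4)] by simp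
    moreover have "card V = (\<Sum>i = 1..m. a i)" by (rule pg(5))
    ultimately have dim: "dim_complex \<Gamma> = (\<Sum>i = 1..m. int (a i)) - int m - 1"
      using dim_indep[OF finV SV gr nonempty cover] by (simp add: \<Gamma>)
    \<comment> \<open>Distinct minimal generators have distinct polarized supports, so disjointness
      of \<open>A\<close> from the pure powers carries over to facets. This decides between the
      sphere and the ball.\<close>
    have S_Fs: "S = Fs \<longleftrightarrow> A = {}"
    proof
      assume "A = {}"
      then show "S = Fs" by (simp add: \<sigma>(2) Fs_def M_def image_image)
    next
      assume eq: "S = Fs"
      have "t \<notin> A" for t
      proof
        assume t: "t \<in> A"
        then have tM: "t \<in> M" by (simp add: M_def)
        then have "\<sigma> ` polset t \<in> S" unfolding \<sigma>(2) by blast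
        then have "\<sigma> ` polset t \<in> Fs" using eq by simp
        then obtain i where i: "i \<in> {1..m}" "\<sigma> ` polset t = \<sigma> ` polset (Poly_Mapping.single i (a i))"
          by (auto simp: Fs_def)
        have "polset t = polset (Poly_Mapping.single i (a i))"
          using inj_on_image_eq_iff[OF bij_betw_imp_inj_on[OF \<sigma>(1)]] i(2) tM a[OF i(1)]
          by (metis UN_upper)
        then have "mdvd t (Poly_Mapping.single i (a i))" by (simp flip: polset_subset_iff)
        then have "t = Poly_Mapping.single i (a i)" using M(2) tM a[OF i(1)] by blast
        then show False using disj t i(1) by blast
      qed
      then show "A = {}" by blast
    qed
    have "vertex_decomposable \<Gamma>" unfolding \<Gamma> by (rule vertex_decomposable_indep[OF finV SV gr])
    moreover have "simplicial_sphere \<Gamma>" if "A = {}"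
      using simplicial_sphere_indep[OF finV SV _ nonempty coverS] gr S_Fs that by (simp add: \<Gamma>)
    moreover have "simplicial_ball \<Gamma>" "\<not> simplicial_sphere \<Gamma>" if "A \<noteq> {}"
      using simplicial_ball_indep[OF finV SV gr nonempty cover anti] S_Fs that by (simp_all add: \<Gamma>)
    ultimately show ?thesis using dim by blast
  qed
  ultimately show ?thesis using I_SR by blast
qed

end
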